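(* Let $X\in\mathbb{R}^{n\times m}$ and let $k\ge 1$ be an integer with $k<\operatorname{rank}(X)$ such that any $k$ columns of $X$ are linearly independent. Then $X$ is $(k-1)$-variation bounding if and only if $X$ is $k$-sign consistent.
   Context: A matrix $X\in\mathbb{R}^{n\times m}$ is $k$-sign consistent if all its $k\times k$ minors are nonnegative, or all its $k\times k$ minors are nonpositive. For a real vector $u\neq0$, $S^-(u)$ is the number of sign changes in $u$ after deleting all zero entries, and $S^-(0):=-1$. $X$ is $j$-variation bounding ($j\in\mathbb{Z}_{\ge0}$) if $S^-(Xu)\le j$ for all $u\in\mathbb{R}^m\setminus\{0\}$ with $S^-(u)\le j$. *)

theory Defs
  imports "HOL.Real" "Jordan_Normal_Form.DL_Submatrix" "Jordan_Normal_Form.DL_Rank"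
begin

definition sign_changes :: "real vec \<Rightarrow> int" where
  "sign_changes u =
     (if u = 0\<^sub>v (dim_vec u) then - 1
      else (let xs = filter (\<lambda>x. x \<noteq> 0) (list_of_vec u)
            in int (card {i. Suc i < length xs \<and> xs ! i * xs ! Suc i < 0})))"

definition variation_bounding :: "nat \<Rightarrow> real mat \<Rightarrow> bool" where
  "variation_bounding j X \<longleftrightarrow>
     (\<forall>u \<in> carrier_vec (dim_col X).
        u \<noteq> 0\<^sub>v (dim_col X) \<longrightarrow> sign_changes u \<le> int j \<longrightarrow> sign_changes (X *\<^sub>v u) \<le> int j)"

(* submatrix enumerates the selected row and column indices in increasing order. *)
definition minors :: "nat \<Rightarrow> real mat \<Rightarrow> real set" where
  "minors k X =
     {det (submatrix X I J) | I J.
        I \<subseteq> {..<dim_row X} \<and> J \<subseteq> {..<dim_col X} \<and> card I = k \<and> card J = k}"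

definition sign_consistent :: "nat \<Rightarrow> real mat \<Rightarrow> bool" where
  "sign_consistent k X \<longleftrightarrow> (\<forall>d \<in> minors k X. d \<ge> 0) \<or> (\<forall>d \<in> minors k X. d \<le> 0)"

(* lin_indpt is a predicate on sets, so without injectivity a repeated column
   would be counted only once. *)
definition any_columns_lin_indpt :: "nat \<Rightarrow> real mat \<Rightarrow> bool" where
  "any_columns_lin_indpt k X \<longleftrightarrow>
     (\<forall>J \<subseteq> {..<dim_col X}. card J = k \<longrightarrow>
        inj_on (col X) J \<and>
        module.lin_indpt class_ring (module_vec TYPE(real) (dim_row X)) (col X ` J))"

end

theory Submission
  imports Defs
begin

text \<open>
  Write \<open>A\<close> for the matrix as a function of two indices, and \<open>minor k A g h\<close> for its minor on the
  rows \<open>g 0 < \<dots> < g (k - 1)\<close> and the columns \<open>h 0 < \<dots> < h (k - 1)\<close>. A vector \<open>v\<close> has at least \<open>k\<close>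
  sign changes exactly if it \<open>oscillates\<close>, that is, takes values of strictly alternating sign at
  some \<open>k + 1\<close> increasing positions (\<open>sign_changes_ge_iff_oscillates\<close>). By duality, it does not
  oscillate exactly if its positions split into at most \<open>k\<close> consecutive blocks inside which it
  does not change sign. The statement then reads: all \<open>k\<close>-minors have the same weak sign if and
  only if \<open>A\<close> maps non-oscillating vectors to non-oscillating ones.

  If the minors have the same sign, let \<open>u\<close> have \<open>k\<close> blocks. Adding up the columns of each block
  with the nonnegative weights \<open>\<bar>u\<^sub>j\<bar>\<close> (or \<open>1\<close> where \<open>u\<close> vanishes on the block) gives a matrix \<open>V\<close>
  with \<open>k\<close> columns, and \<open>A u = V c\<close> with a vector \<open>c\<close> of signs, possibly zero. The minors of \<open>V\<close>
  are nonnegative combinations of minors of \<open>A\<close>, so they still have the same weak sign, and one of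
  them is nonzero because any \<open>k\<close> columns of \<open>A\<close> are independent. Suppose that \<open>V c\<close> alternates on
  rows \<open>f 0 < \<dots> < f k\<close>. The vector \<open>V c\<close> is orthogonal to the signed minors,
  \<open>\<Sum>\<^sub>i (-1)\<^sup>i (V c)(f i) p\<^sub>i = 0\<close>, where \<open>p\<^sub>i\<close> omits row \<open>f i\<close>; all terms have the same weak sign,
  so all \<open>p\<^sub>i\<close> vanish. This is a contradiction only if some \<open>p\<^sub>i\<close> is nonzero, and this is arranged
  beforehand: adding a small multiple of a row to a neighbouring row preserves the alternation and
  the weak signs, and moves a nonzero minor by one unit step; along a path of unit steps it
  reaches the rows \<open>f 0, \<dots>, f (k - 1)\<close> (\<open>same_sign_minors_imp_not_oscillates\<close>).

  Conversely, assume that \<open>A\<close> is variation bounding. On fixed columns, two minors of opposite sign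
  whose row sets lie in a common set of \<open>k + 1\<close> rows leave room, by the same orthogonality
  relation, for a combination of the columns that alternates there; basis exchange reduces any
  pair of minors to such a pair (\<open>not_oscillates_imp_same_sign_minors\<close>). So every column set has a
  sign. It remains to compare the column sets that differ by moving one column \<open>c\<close> to \<open>c + 1\<close>; let
  \<open>H\<close> be their union, and suppose that the signs differ
  (\<open>opposite_adjacent_columns_contradiction\<close>). If some \<open>(k + 1)\<close>-minor on \<open>H\<close> is nonzero, the
  solution of \<open>A u = (1, -1, 1, \<dots>)\<close> on its rows has, by Cramer's rule, weakly equal signs at \<open>c\<close>
  and \<open>c + 1\<close>, so \<open>u\<close> does not oscillate while its image does. Otherwise a kernel vector \<open>z\<close> lives
  on \<open>H\<close>; its entries are nonzero and those at \<open>c\<close> and \<open>c + 1\<close> have equal signs. Since the rank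
  exceeds \<open>k\<close>, an additional column gives a vector \<open>v\<close> whose image alternates on \<open>k + 1\<close> rows. For
  small \<open>\<delta>\<close> and a suitable choice of sign, \<open>z \<plusminus> \<delta> v\<close> has the block structure of \<open>z\<close> and hence does
  not oscillate, but its image is a multiple of the image of \<open>v\<close>.
\<close>

section \<open>Increasing index maps and minors\<close>

text \<open>
  A \<open>k\<close>-subset of \<open>{..<N}\<close> is represented by its increasing enumeration; only the values on
  \<open>{..<k}\<close> matter. This makes minors determinants of reindexed matrices, and omitting an element
  becomes composition with \<open>insert_index\<close>.
\<close>

definition increasing_maps :: "nat \<Rightarrow> nat \<Rightarrow> (nat \<Rightarrow> nat) set" where
  "increasing_maps k N = {g. (\<forall>i j. i < j \<longrightarrow> j < k \<longrightarrow> g i < g j) \<and> (\<forall>i<k. g i < N)}"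

definition minor :: "nat \<Rightarrow> (nat \<Rightarrow> nat \<Rightarrow> real) \<Rightarrow> (nat \<Rightarrow> nat) \<Rightarrow> (nat \<Rightarrow> nat) \<Rightarrow> real" where
  "minor k A g h = det (mat k k (\<lambda>(r, s). A (g r) (h s)))"

lemma increasing_mapsD:
  assumes "g \<in> increasing_maps k N"
  shows "i < j \<Longrightarrow> j < k \<Longrightarrow> g i < g j" and "i < k \<Longrightarrow> g i < N"
  using assms by (auto simp: increasing_maps_def)

lemma increasing_maps_inj:
  assumes "g \<in> increasing_maps k N"
  shows "inj_on g {..<k}"
proof (rule inj_onI)
  fix i j assume "i \<in> {..<k}" "j \<in> {..<k}" and eq: "g i = g j"
  then show "i = j"
    using increasing_mapsD(1)[OF assms, of i j] increasing_mapsD(1)[OF assms, of j i]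
    by (cases i j rule: linorder_cases) auto
qed

lemma increasing_maps_image:
  assumes "g \<in> increasing_maps k N"
  shows "g ` {..<k} \<subseteq> {..<N}" and "card (g ` {..<k}) = k"
  using increasing_mapsD(2)[OF assms] card_image[OF increasing_maps_inj[OF assms]] by auto

lemma increasing_maps_enumeration:
  assumes "I \<subseteq> {..<N}" and "card I = k"
  shows "pick I \<in> increasing_maps k N" and "pick I ` {..<k} = I"
proof -
  have fin: "finite I" using assms(1) finite_subset by blast
  have mem: "pick I i \<in> I" if "i < k" for i using that assms(2) pick_in_set_le by auto
  have mono: "pick I i < pick I j" if "i < j" "j < k" for i j
    using that assms(2) pick_mono_le by auto
  show inc: "pick I \<in> increasing_maps k N"
    using mem mono assms(1) by (auto simp: increasing_maps_def)
  show "pick I ` {..<k} = I"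
    using mem increasing_maps_image(2)[OF inc] assms(2) fin
    by (intro card_subset_eq) auto
qed

lemma increasing_maps_unique:
  assumes "g \<in> increasing_maps k N" "g' \<in> increasing_maps k N'"
    and "g ` {..<k} = g' ` {..<k}" and "s < k"
  shows "g s = g' s"
proof -
  have srt: "sorted_wrt (<) (map f [0..<k])" if "f \<in> increasing_maps k M" for f M
    using increasing_mapsD(1)[OF that] by (auto simp: sorted_wrt_iff_nth_less)
  have "map g [0..<k] = map g' [0..<k]"
    using srt[OF assms(1)] srt[OF assms(2)] assms(3)
    by (intro strict_sorted_equal) (auto simp: atLeast0LessThan)
  then show ?thesis using assms(4) by auto
qed

lemma minor_cong:
  assumes "\<And>r s. r < k \<Longrightarrow> s < k \<Longrightarrow> A (g r) (h s) = A' (g' r) (h' s)"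
  shows "minor k A g h = minor k A' g' h'"
  unfolding minor_def using assms by (intro arg_cong[of _ _ det] eq_matI) auto

lemma minor_transpose: "minor k A g h = minor k (\<lambda>i j. A j i) h g"
proof -
  let ?M = "mat k k (\<lambda>(r, s). A (g r) (h s))"
  have "?M\<^sup>T = mat k k (\<lambda>(r, s). A (g s) (h r))" by (intro eq_matI) auto
  then show ?thesis unfolding minor_def using det_transpose[of ?M k] by simp
qed

lemma mult_mat_vec_entry:
  assumes "r < k"
  shows "(mat k l (\<lambda>(r, s). B r s) *\<^sub>v vec l c) $ r = (\<Sum>s<l. B r s * c s)"
  using assms by (auto simp: scalar_prod_def atLeast0LessThan)

lemma minor_eq_0_iff_kernel:
  "minor k A g h = 0 \<longleftrightarrow> (\<exists>c. (\<exists>s<k. c s \<noteq> 0) \<and> (\<forall>r<k. (\<Sum>s<k. A (g r) (h s) * c s) = 0))"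
proof -
  let ?M = "mat k k (\<lambda>(r, s). A (g r) (h s))"
  have M: "?M \<in> carrier_mat k k" by simp
  show ?thesis
  proof
    assume "minor k A g h = 0"
    then obtain v where v: "v \<in> carrier_vec k" "v \<noteq> 0\<^sub>v k" "?M *\<^sub>v v = 0\<^sub>v k"
      using det_0_iff_vec_prod_zero_field[OF M] unfolding minor_def by auto
    have vv: "v = vec k (\<lambda>s. v $ s)" using v(1) by auto
    have "\<exists>s<k. v $ s \<noteq> 0" using v(1,2) by (metis carrier_vecD eq_vecI index_zero_vec)
    moreover have "(\<Sum>s<k. A (g r) (h s) * v $ s) = 0" if "r < k" for r
      using mult_mat_vec_entry[OF that, of k "\<lambda>r s. A (g r) (h s)" "\<lambda>s. v $ s"] v(3) that vv
      by (metis index_zero_vec(1))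
    ultimately show "\<exists>c. (\<exists>s<k. c s \<noteq> 0) \<and> (\<forall>r<k. (\<Sum>s<k. A (g r) (h s) * c s) = 0)"
      by (intro exI[of _ "\<lambda>s. v $ s"]) auto
  next
    assume "\<exists>c. (\<exists>s<k. c s \<noteq> 0) \<and> (\<forall>r<k. (\<Sum>s<k. A (g r) (h s) * c s) = 0)"
    then obtain c t where c: "t < k" "c t \<noteq> 0" "\<forall>r<k. (\<Sum>s<k. A (g r) (h s) * c s) = 0" by auto
    have "vec k c \<noteq> 0\<^sub>v k" using c(1,2) by (metis index_vec index_zero_vec(1))
    moreover have "?M *\<^sub>v vec k c = 0\<^sub>v k"
    proof (rule eq_vecI)
      fix r assume "r < dim_vec (0\<^sub>v k :: real vec)"
      then have "r < k" by simp
      then show "(?M *\<^sub>v vec k c) $ r = 0\<^sub>v k $ r"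
        using mult_mat_vec_entry[of r k k "\<lambda>r s. A (g r) (h s)" c] c(3) by simp
    qed simp
    ultimately show "minor k A g h = 0"
      using det_0_iff_vec_prod_zero_field[OF M] vec_carrier[of k c] unfolding minor_def by blast
  qed
qed

text \<open>
  The condition on the right depends on the rows only as a set. This is what makes basis exchange
  free of permutation signs.
\<close>

lemma minor_nonzero_iff_injective:
  "minor k A g h \<noteq> 0 \<longleftrightarrow>
     (\<forall>c. (\<forall>i\<in>g ` {..<k}. (\<Sum>s<k. A i (h s) * c s) = 0) \<longrightarrow> (\<forall>s<k. c s = 0))"
  unfolding minor_eq_0_iff_kernel by auto

lemma minor_nonzeroD:
  assumes "minor k A g h \<noteq> 0" and "\<And>r. r < k \<Longrightarrow> (\<Sum>s<k. A (g r) (h s) * c s) = 0" and "s < k"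
  shows "c s = 0"
proof (rule ccontr)
  assume "c s \<noteq> 0"
  then have "minor k A g h = 0"
    unfolding minor_eq_0_iff_kernel using assms(2,3) by (intro exI[of _ c]) auto
  then show False using assms(1) by simp
qed

lemma smult_mat_vec_eq:
  fixes a :: real
  assumes "v \<in> carrier_vec k"
  shows "(a \<cdot>\<^sub>m 1\<^sub>m k) *\<^sub>v v = a \<cdot>\<^sub>v v"
  using assms by (intro eq_vecI) (auto simp: smult_scalar_prod_distrib[of _ k])

text \<open>
  The adjugate times \<open>A u = y\<close>, entry \<open>j\<close>, written with minors on index maps that omit one row and
  one column.
\<close>

lemma minor_Cramer:
  assumes "\<And>i. i < Suc k \<Longrightarrow> (\<Sum>s<Suc k. A (f i) (H s) * u s) = y i" and "j < Suc k"
  shows "minor (Suc k) A f H * u j =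
    (\<Sum>i<Suc k. (-1) ^ (i + j) * y i * minor k A (f \<circ> insert_index i) (H \<circ> insert_index j))"
proof -
  let ?M = "mat (Suc k) (Suc k) (\<lambda>(r, s). A (f r) (H s))"
  let ?u = "vec (Suc k) u"
  have M: "?M \<in> carrier_mat (Suc k) (Suc k)" by simp
  have y: "?M *\<^sub>v ?u = vec (Suc k) y"
  proof (rule eq_vecI)
    fix r assume "r < dim_vec (vec (Suc k) y)"
    then have r: "r < Suc k" by simp
    show "(?M *\<^sub>v ?u) $ r = vec (Suc k) y $ r"
      using mult_mat_vec_entry[OF r, of "Suc k" "\<lambda>r s. A (f r) (H s)" u] assms(1)[OF r] r by simp
  qed simp
  have "adj_mat ?M *\<^sub>v (?M *\<^sub>v ?u) = (adj_mat ?M * ?M) *\<^sub>v ?u"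
    by (rule assoc_mult_mat_vec[symmetric, OF adj_mat(1)[OF M] M]) simp
  also have "\<dots> = det ?M \<cdot>\<^sub>v ?u"
    unfolding adj_mat(3)[OF M]
    by (rule smult_mat_vec_eq) simp
  finally have "(det ?M \<cdot>\<^sub>v ?u) $ j = (adj_mat ?M *\<^sub>v vec (Suc k) y) $ j" using y by simp
  also have "\<dots> = (\<Sum>i<Suc k. cofactor ?M i j * y i)"
    using assms(2) by (simp add: adj_mat_def scalar_prod_def atLeast0LessThan)
  also have "\<dots> = (\<Sum>i<Suc k. (-1) ^ (i + j) * y i *
      minor k A (f \<circ> insert_index i) (H \<circ> insert_index j))"
  proof (rule sum.cong)
    fix i assume "i \<in> {..<Suc k}"
    have "mat_delete ?M i j = mat k k (\<lambda>(r, s). A ((f \<circ> insert_index i) r) ((H \<circ> insert_index j) s))"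
      unfolding mat_delete_def insert_index_def by (rule eq_matI) auto
    then show "cofactor ?M i j * y i = (-1) ^ (i + j) * y i *
        minor k A (f \<circ> insert_index i) (H \<circ> insert_index j)"
      unfolding cofactor_def minor_def by simp
  qed simp
  finally show ?thesis unfolding minor_def using assms(2) by simp
qed

lemma minor_solve:
  assumes "minor k A g h \<noteq> 0"
  shows "\<exists>c. \<forall>r<k. (\<Sum>s<k. A (g r) (h s) * c s) = y r"
proof -
  let ?M = "mat k k (\<lambda>(r, s). A (g r) (h s))"
  have M: "?M \<in> carrier_mat k k" by simp
  define c where "c = (\<lambda>s. (adj_mat ?M *\<^sub>v vec k y) $ s / det ?M)"
  have cv: "det ?M \<cdot>\<^sub>v vec k c = adj_mat ?M *\<^sub>v vec k y"
    using assms adj_mat(1)[OF M] by (intro eq_vecI) (auto simp: c_def minor_def)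
  have "?M *\<^sub>v (det ?M \<cdot>\<^sub>v vec k c) = (?M * adj_mat ?M) *\<^sub>v vec k y"
    unfolding cv by (rule assoc_mult_mat_vec[symmetric, OF M adj_mat(1)[OF M]]) simp
  also have "\<dots> = det ?M \<cdot>\<^sub>v vec k y"
    unfolding adj_mat(2)[OF M] by (rule smult_mat_vec_eq) simp
  also have "?M *\<^sub>v (det ?M \<cdot>\<^sub>v vec k c) = det ?M \<cdot>\<^sub>v (?M *\<^sub>v vec k c)"
    by (rule mult_mat_vec[OF M]) simp
  finally have eq: "det ?M \<cdot>\<^sub>v (?M *\<^sub>v vec k c) = det ?M \<cdot>\<^sub>v vec k y" .
  have "(\<Sum>s<k. A (g r) (h s) * c s) = y r" if r: "r < k" for r
  proof -
    have "det ?M * (?M *\<^sub>v vec k c) $ r = det ?M * y r"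
      using arg_cong[OF eq, of "\<lambda>v. v $ r"] r by simp
    then have "(?M *\<^sub>v vec k c) $ r = y r" using assms by (simp add: minor_def)
    then show ?thesis using mult_mat_vec_entry[OF r, of k "\<lambda>r s. A (g r) (h s)" c] by simp
  qed
  then show ?thesis by blast
qed

text \<open>
  Vectors in the column space of a matrix with \<open>k\<close> columns are orthogonal to the signed minors on
  any \<open>k + 1\<close> rows: prefixing the vector as an additional column gives a singular matrix, and
  Laplace expansion along that column is the claim.
\<close>

lemma minor_orthogonality:
  "(\<Sum>i<Suc k. (-1) ^ i * (\<Sum>s<k. A (f i) (h s) * c s) * minor k A (f \<circ> insert_index i) h) = 0"
proof -
  define y where "y = (\<lambda>i. \<Sum>s<k. A i (h s) * c s)"
  define B where "B = (\<lambda>i s. if s = 0 then y i else A i (h (s - 1)))"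
  define u where "u = (\<lambda>s. if s = 0 then - 1 else c (s - 1))"
  have "(\<Sum>s<Suc k. B (f i) (id s) * u s) = 0" for i
    by (simp add: sum.lessThan_Suc_shift B_def u_def y_def del: sum.lessThan_Suc)
  then have "minor (Suc k) B f id = 0"
    unfolding minor_eq_0_iff_kernel by (intro exI[of _ u]) (auto simp: u_def)
  moreover have "minor (Suc k) B f id * (if (0::nat) = 0 then 1 else 0) =
    (\<Sum>i<Suc k. (-1) ^ (i + 0) * y (f i) * minor k B (f \<circ> insert_index i) (id \<circ> insert_index 0))"
    by (rule minor_Cramer[where u = "\<lambda>s. if s = 0 then 1 else 0"])
      (simp_all add: sum.lessThan_Suc_shift B_def del: sum.lessThan_Suc)
  moreover have "minor k B (f \<circ> insert_index i) (id \<circ> insert_index 0) =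
      minor k A (f \<circ> insert_index i) h" for i
    by (rule minor_cong) (simp add: B_def)
  ultimately show ?thesis by (simp add: y_def)
qed

text \<open>
  Full column rank is seen by a minor. In the induction, the kernel of the first \<open>k\<close> chosen rows
  is a line; a row that does not vanish on it completes the selection.
\<close>

lemma exists_nonzero_minor:
  assumes "\<And>c. (\<And>i. i < N \<Longrightarrow> (\<Sum>s<k. A i (h s) * c s) = 0) \<Longrightarrow> \<forall>s<k. c s = 0"
  shows "\<exists>g\<in>increasing_maps k N. minor k A g h \<noteq> 0"
  using assms
proof (induction k)
  case 0
  show ?case by (intro bexI[of _ id]) (auto simp: minor_def increasing_maps_def)
next
  case (Suc k)
  have "\<forall>s<k. c s = 0" if c: "\<And>i. i < N \<Longrightarrow> (\<Sum>s<k. A i (h s) * c s) = 0" for c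
  proof -
    have "\<forall>s<Suc k. (if s < k then c s else 0) = 0"
      by (rule Suc.prems) (use c in simp)
    then show ?thesis by (metis less_SucI)
  qed
  then obtain g where g: "g \<in> increasing_maps k N" "minor k A g h \<noteq> 0" using Suc.IH by blast
  obtain c where c: "\<forall>r<k. (\<Sum>s<k. A (g r) (h s) * c s) = - A (g r) (h k)"
    using minor_solve[OF g(2), of "\<lambda>r. - A (g r) (h k)"] by (elim exE)
  define d where "d = (\<lambda>s. if s < k then c s else 1)"
  have d: "(\<Sum>s<Suc k. A i (h s) * d s) = (\<Sum>s<k. A i (h s) * c s) + A i (h k)" for i
    by (simp add: d_def)
  have "\<exists>i<N. (\<Sum>s<Suc k. A i (h s) * d s) \<noteq> 0"
  proof (rule ccontr)
    assume "\<not> (\<exists>i<N. (\<Sum>s<Suc k. A i (h s) * d s) \<noteq> 0)"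
    then have "\<forall>s<Suc k. d s = 0" by (intro Suc.prems) metis
    then have "d k = 0" by simp
    then show False by (simp add: d_def)
  qed
  then obtain i where i: "i < N" "(\<Sum>s<Suc k. A i (h s) * d s) \<noteq> 0" by (elim exE conjE)
  have ni: "i \<notin> g ` {..<k}" using i(2) c unfolding d by force
  let ?I = "insert i (g ` {..<k})"
  have I: "?I \<subseteq> {..<N}" "card ?I = Suc k"
    using i(1) ni increasing_maps_image[OF g(1)] by auto
  have "minor (Suc k) A (pick ?I) h \<noteq> 0"
    unfolding minor_nonzero_iff_injective increasing_maps_enumeration(2)[OF I]
  proof (rule allI, rule impI)
    fix e assume e: "\<forall>i\<in>?I. (\<Sum>s<Suc k. A i (h s) * e s) = 0"
    have lin: "(\<Sum>s<Suc k. A j (h s) * (e s - e k * d s)) =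
        (\<Sum>s<Suc k. A j (h s) * e s) - e k * (\<Sum>s<Suc k. A j (h s) * d s)" for j
      by (simp add: right_diff_distrib sum_subtractf sum_distrib_left mult.left_commute
          del: sum.lessThan_Suc)
    have z: "(\<Sum>s<k. A j (h s) * (e s - e k * d s)) = 0" if "j \<in> g ` {..<k}" for j
    proof -
      have "(\<Sum>s<Suc k. A j (h s) * (e s - e k * d s)) = 0"
        unfolding lin using e that c d by auto
      then show ?thesis by (simp add: d_def)
    qed
    have ed: "e s - e k * d s = 0" if "s < k" for s
      by (rule minor_nonzeroD[OF g(2) _ that, where c = "\<lambda>s. e s - e k * d s"], rule z) simp
    have all: "e s = e k * d s" if "s < Suc k" for s
      using ed[of s] that by (cases "s = k") (simp_all add: d_def)
    have "(\<Sum>s<Suc k. A i (h s) * e s) = (\<Sum>s<Suc k. e k * (A i (h s) * d s))"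
    proof (rule sum.cong)
      fix s assume "s \<in> {..<Suc k}"
      then show "A i (h s) * e s = e k * (A i (h s) * d s)"
        using all[of s] by (metis lessThan_iff mult.left_commute)
    qed simp
    also have "\<dots> = e k * (\<Sum>s<Suc k. A i (h s) * d s)" by (rule sum_distrib_left[symmetric])
    finally have "e k * (\<Sum>s<Suc k. A i (h s) * d s) = 0" using e by simp
    then have "e k = 0" using i(2) by simp
    show "\<forall>s<Suc k. e s = 0"
    proof (intro allI impI)
      fix s assume "s < Suc k"
      then show "e s = 0" using all[of s] \<open>e k = 0\<close> by (metis mult_zero_left)
    qed
  qed
  then show ?case using increasing_maps_enumeration(1)[OF I] by blast
qed

section \<open>Sign changes, alternations and blocks\<close>

definition alternates_along :: "nat \<Rightarrow> (nat \<Rightarrow> real) \<Rightarrow> (nat \<Rightarrow> nat) \<Rightarrow> bool" where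
  "alternates_along k v f \<longleftrightarrow> (\<forall>j<k. v (f j) * v (f (Suc j)) < 0)"

text \<open>
  For \<open>k \<ge> 1\<close> this expresses that \<open>v\<close> has at least \<open>k\<close> sign changes after deleting its zeros.
\<close>

definition oscillates :: "nat \<Rightarrow> nat \<Rightarrow> (nat \<Rightarrow> real) \<Rightarrow> bool" where
  "oscillates k N v \<longleftrightarrow> (\<exists>f\<in>increasing_maps (Suc k) N. alternates_along k v f)"

lemma increasing_maps_prefix:
  assumes "g \<in> increasing_maps l N" and "k \<le> l"
  shows "g \<in> increasing_maps k N"
  using assms by (auto simp: increasing_maps_def)

lemma oscillates_mono:
  assumes "oscillates l N v" and "k \<le> l"
  shows "oscillates k N v"
proof -
  obtain f where "f \<in> increasing_maps (Suc l) N" "alternates_along l v f"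
    using assms(1) by (auto simp: oscillates_def)
  then have "f \<in> increasing_maps (Suc k) N" "alternates_along k v f"
    using assms(2) increasing_maps_prefix[of f "Suc l" N "Suc k"] by (auto simp: alternates_along_def)
  then show ?thesis by (auto simp: oscillates_def)
qed

lemma increasing_maps_extend:
  assumes "f \<in> increasing_maps (Suc k) N" and "N \<le> b" and "b < M"
  shows "f(Suc k := b) \<in> increasing_maps (Suc (Suc k)) M"
proof -
  note f = increasing_mapsD[OF assms(1)]
  have "f i < b" if "i < Suc k" for i using f(2)[OF that] assms(2) by simp
  moreover have "f i < M" if "i < Suc k" for i using f(2)[OF that] assms(2,3) by simp
  ultimately show ?thesis
    using f(1) assms(3) unfolding increasing_maps_def by (simp add: less_Suc_eq)
qed

lemma increasing_maps_widen:
  assumes "f \<in> increasing_maps k N" and "N \<le> M"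
  shows "f \<in> increasing_maps k M"
  using assms by (fastforce simp: increasing_maps_def)

text \<open>
  The block number has to increase at each sign change, so \<open>k\<close> blocks allow fewer than \<open>k\<close>
  changes.
\<close>

lemma blocks_imp_not_oscillates:
  assumes mono: "\<And>i j. i \<le> j \<Longrightarrow> j < N \<Longrightarrow> \<beta> i \<le> \<beta> j"
    and bound: "\<And>i. i < N \<Longrightarrow> \<beta> i < k"
    and const: "\<And>i j. i < j \<Longrightarrow> j < N \<Longrightarrow> \<beta> i = \<beta> j \<Longrightarrow> 0 \<le> u i * u j"
  shows "\<not> oscillates k N u"
proof
  assume "oscillates k N u"
  then obtain f where f: "f \<in> increasing_maps (Suc k) N" "alternates_along k u f"
    by (auto simp: oscillates_def)
  have "j \<le> \<beta> (f j)" if "j < Suc k" for j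
    using that
  proof (induction j)
    case (Suc j)
    have lt: "f j < f (Suc j)" "f (Suc j) < N"
      using increasing_mapsD[OF f(1)] Suc.prems by auto
    have "u (f j) * u (f (Suc j)) < 0" using f(2) Suc.prems by (simp add: alternates_along_def)
    then have "\<beta> (f j) \<noteq> \<beta> (f (Suc j))" using const[OF lt] by auto
    moreover have "\<beta> (f j) \<le> \<beta> (f (Suc j))" using mono lt by simp
    ultimately show ?case using Suc by simp
  qed simp
  then have "k \<le> \<beta> (f k)" by simp
  then show False using bound[of "f k"] increasing_mapsD(2)[OF f(1), of k] by simp
qed

text \<open>
  A longest alternation and a partition into as few sign-constant blocks as possible are built
  simultaneously, one position at a time; \<open>j\<close> is both the number of changes and the number of the
  last block. The last alternation point carries the sign of the last block; it is zero only as
  long as all values are.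
\<close>

lemma exists_alternation_and_blocks:
  fixes u :: "nat \<Rightarrow> real"
  shows "\<exists>j f \<beta>. f \<in> increasing_maps (Suc j) (Suc N) \<and> alternates_along j u f \<and>
    \<beta> 0 = 0 \<and> (\<forall>i. \<beta> i \<le> \<beta> (Suc i) \<and> \<beta> (Suc i) \<le> Suc (\<beta> i)) \<and> (\<forall>i\<ge>N. \<beta> i = j) \<and>
    (\<forall>i i'. i \<le> N \<longrightarrow> i' \<le> N \<longrightarrow> \<beta> i = \<beta> i' \<longrightarrow> 0 \<le> u i * u i') \<and>
    (\<forall>i\<le>N. \<beta> i = j \<longrightarrow> 0 \<le> u i * u (f j)) \<and>
    (u (f j) = 0 \<longrightarrow> j = 0 \<and> (\<forall>i\<le>N. u i = 0))"
proof (induction N)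
  case 0
  show ?case
    by (intro exI[of _ 0] exI[of _ "\<lambda>_. 0"])
      (auto simp: increasing_maps_def alternates_along_def)
next
  case (Suc N)
  then obtain j f \<beta> where f: "f \<in> increasing_maps (Suc j) (Suc N)" "alternates_along j u f"
    and \<beta>: "\<beta> 0 = 0" "\<And>i. \<beta> i \<le> \<beta> (Suc i) \<and> \<beta> (Suc i) \<le> Suc (\<beta> i)" "\<And>i. i \<ge> N \<Longrightarrow> \<beta> i = j"
    and const: "\<And>i i'. i \<le> N \<Longrightarrow> i' \<le> N \<Longrightarrow> \<beta> i = \<beta> i' \<Longrightarrow> 0 \<le> u i * u i'"
    and last: "\<And>i. i \<le> N \<Longrightarrow> \<beta> i = j \<Longrightarrow> 0 \<le> u i * u (f j)"
    and zero: "u (f j) = 0 \<Longrightarrow> j = 0 \<and> (\<forall>i\<le>N. u i = 0)"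
    by blast
  have mono: "\<beta> i \<le> \<beta> i'" if "i \<le> i'" for i i' using lift_Suc_mono_le[of \<beta>, OF _ that] \<beta>(2) by blast
  consider (same) "u (f j) \<noteq> 0" "0 \<le> u (f j) * u (Suc N)"
    | (zero) "u (f j) = 0" | (change) "u (f j) * u (Suc N) < 0" by linarith
  then show ?case
  proof cases
    case same
    have l: "0 \<le> u i * u (f j)" if "i \<le> Suc N" "\<beta> i = j" for i
      using last[of i] that same(2) by (cases "i = Suc N") (auto simp: mult.commute)
    have c: "0 \<le> u i * u i'" if "i \<le> Suc N" "i' \<le> Suc N" "\<beta> i = \<beta> i'" for i i'
    proof (cases "\<beta> i = j")
      case True
      then have "0 \<le> (u i * u (f j)) * (u i' * u (f j))"
        using mult_nonneg_nonneg[OF l[of i] l[of i']] that by simp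
      also have "\<dots> = (u i * u i') * (u (f j))\<^sup>2" by (simp add: power2_eq_square algebra_simps)
      finally show ?thesis using same(1) by (simp add: zero_le_mult_iff)
    next
      case False
      then have "i \<le> N" "i' \<le> N" using \<beta>(3) that by (metis le_SucE Suc_n_not_le_n nat_le_linear)+
      then show ?thesis using const that(3) by blast
    qed
    show ?thesis
      using increasing_maps_widen[OF f(1), of "Suc (Suc N)"] f(2) \<beta> c l same(1)
      by (intro exI[of _ j] exI[of _ f] exI[of _ \<beta>]) auto
  next
    case zero
    then have z: "j = 0" "\<And>i. i \<le> N \<Longrightarrow> u i = 0" using \<open>u (f j) = 0 \<Longrightarrow> _\<close> by auto
    have b0: "\<beta> i = 0" for i using mono[of i "max i N"] \<beta>(3)[of "max i N"] z(1) by simp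
    have nz: "i = Suc N" if "i \<le> Suc N" "u i \<noteq> 0" for i using z(2)[of i] that by (cases "i \<le> N") auto
    have "0 \<le> u i * u i'" if "i \<le> Suc N" "i' \<le> Suc N" for i i'
      using nz[OF that(1)] nz[OF that(2)] by (cases "u i = 0"; cases "u i' = 0") auto
    then show ?thesis
      using b0 nz by (intro exI[of _ 0] exI[of _ "\<lambda>_. Suc N"] exI[of _ \<beta>])
        (auto simp: increasing_maps_def alternates_along_def)
  next
    case change
    define f' where "f' = f(Suc j := Suc N)"
    define \<beta>' where "\<beta>' = (\<lambda>i. if i \<le> N then \<beta> i else Suc j)"
    have bj: "\<beta> i \<le> j" if "i \<le> N" for i using mono[OF that] \<beta>(3)[of N] by simp
    have 1: "f' \<in> increasing_maps (Suc (Suc j)) (Suc (Suc N))"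
      unfolding f'_def by (rule increasing_maps_extend[OF f(1)]) auto
    have 2: "alternates_along (Suc j) u f'"
      using f(2) change by (auto simp: alternates_along_def f'_def less_Suc_eq)
    have 3: "\<beta>' i \<le> \<beta>' (Suc i) \<and> \<beta>' (Suc i) \<le> Suc (\<beta>' i)" for i
      using \<beta>(2)[of i] bj[of i] \<beta>(3)[of N] by (cases "i = N") (auto simp: \<beta>'_def)
    have 4: "0 \<le> u i * u i'" if "i \<le> Suc N" "i' \<le> Suc N" "\<beta>' i = \<beta>' i'" for i i'
    proof (cases "i \<le> N")
      case True
      then show ?thesis using that bj[of i] const[of i i'] by (auto simp: \<beta>'_def split: if_splits)
    next
      case False
      then have "i' = i" using that bj[of i'] by (auto simp: \<beta>'_def le_Suc_eq split: if_splits)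
      then show ?thesis by simp
    qed
    have 5: "0 \<le> u i * u (f' (Suc j))" if "i \<le> Suc N" "\<beta>' i = Suc j" for i
      using that bj[of i] by (auto simp: \<beta>'_def f'_def le_Suc_eq split: if_splits)
    have 6: "u (f' (Suc j)) \<noteq> 0" using change by (auto simp: f'_def)
    show ?thesis
      using 1 2 3 4 5 6 \<beta>(1) by (intro exI[of _ "Suc j"] exI[of _ f'] exI[of _ \<beta>'])
        (auto simp: \<beta>'_def)
  qed
qed

lemma unit_steps_hit:
  fixes \<beta> :: "nat \<Rightarrow> nat"
  assumes "\<And>i. \<beta> (Suc i) \<le> Suc (\<beta> i)" and "\<beta> 0 = 0" and "s \<le> \<beta> n"
  shows "\<exists>i\<le>n. \<beta> i = s"
  using assms(3)
proof (induction n)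
  case 0
  then show ?case using assms(2) by auto
next
  case (Suc n)
  show ?case
  proof (cases "s \<le> \<beta> n")
    case True
    then show ?thesis using Suc.IH le_SucI by blast
  next
    case False
    then have "\<beta> (Suc n) = s" using assms(1)[of n] Suc.prems by simp
    then show ?thesis by blast
  qed
qed

text \<open>
  The converse of the previous count, with exactly \<open>k\<close> nonempty blocks. A partition with too few
  blocks is refined by cutting off trailing singletons.
\<close>

lemma not_oscillates_imp_blocks:
  assumes "\<not> oscillates k N u" and "1 \<le> k" and "k \<le> N"
  obtains \<beta> where "\<And>i j. i \<le> j \<Longrightarrow> \<beta> i \<le> \<beta> j" and "\<And>i. i < N \<Longrightarrow> \<beta> i < k"
    and "\<And>s. s < k \<Longrightarrow> \<exists>i<N. \<beta> i = s"
    and "\<And>i j. i < N \<Longrightarrow> j < N \<Longrightarrow> \<beta> i = \<beta> j \<Longrightarrow> 0 \<le> u i * u j"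
proof -
  obtain M where N: "N = Suc M" using assms(2,3) by (cases N) auto
  obtain j f \<gamma> where f: "f \<in> increasing_maps (Suc j) N" "alternates_along j u f"
    and \<gamma>: "\<gamma> 0 = 0" "\<And>i. \<gamma> i \<le> \<gamma> (Suc i) \<and> \<gamma> (Suc i) \<le> Suc (\<gamma> i)" "\<And>i. i \<ge> M \<Longrightarrow> \<gamma> i = j"
    and const: "\<And>i i'. i \<le> M \<Longrightarrow> i' \<le> M \<Longrightarrow> \<gamma> i = \<gamma> i' \<Longrightarrow> 0 \<le> u i * u i'"
    using exists_alternation_and_blocks[of M u] unfolding N by blast
  have "\<not> k \<le> j" using assms(1) oscillates_mono[of j N u k] f by (auto simp: oscillates_def)
  then have jk: "j < k" by simp
  have mono: "\<gamma> i \<le> \<gamma> i'" if "i \<le> i'" for i i' using lift_Suc_mono_le[of \<gamma>, OF _ that] \<gamma>(2) by blast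
  \<comment> \<open>The second argument grows strictly up to \<open>k - 1\<close> at the end, so the maximum is onto \<open>{..<k}\<close> and
    two positions share a block only if they already did under \<open>\<gamma>\<close>.\<close>
  define \<beta> where "\<beta> = (\<lambda>i. max (\<gamma> i) (i - (N - k)))"
  have \<beta>_step: "\<beta> (Suc i) \<le> Suc (\<beta> i)" for i using \<gamma>(2)[of i] by (auto simp: \<beta>_def)
  have \<beta>_mono: "\<beta> i \<le> \<beta> i'" if "i \<le> i'" for i i'
    unfolding \<beta>_def using mono[OF that] that by (intro max.mono) auto
  have same: "\<gamma> i = \<gamma> i'" if "\<beta> i = \<beta> i'" "i \<le> i'" for i i'
  proof (cases "i = i'")
    case False
    then have "i < i'" using that(2) by simp
    then show ?thesis using that(1) mono[OF that(2)] unfolding \<beta>_def by linarith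
  qed simp
  show thesis
  proof
    show "\<beta> i \<le> \<beta> i'" if "i \<le> i'" for i i' using \<beta>_mono[OF that] .
    show "\<beta> i < k" if "i < N" for i
      using mono[of i M] \<gamma>(3)[of M] jk that N assms(2,3) by (auto simp: \<beta>_def)
    show "\<exists>i<N. \<beta> i = s" if "s < k" for s
    proof -
      have "s \<le> \<beta> M" using that N assms(3) by (auto simp: \<beta>_def)
      then obtain i where "i \<le> M" "\<beta> i = s"
        using unit_steps_hit[of \<beta> s M, OF \<beta>_step] \<gamma>(1) assms(3) by (auto simp: \<beta>_def)
      then show ?thesis using N by (intro exI[of _ i]) simp
    qed
    show "0 \<le> u i * u i'" if "i < N" "i' < N" "\<beta> i = \<beta> i'" for i i'
    proof (rule const)
      show "\<gamma> i = \<gamma> i'"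
        using same[of i i'] same[of i' i] that(3) by (metis nat_le_linear)
    qed (use that N in simp_all)
  qed
qed

text \<open>
  Sign changes between neighbouring positions. For vectors without zeros, this is the number of
  sign changes.
\<close>

definition sign_switches :: "nat \<Rightarrow> (nat \<Rightarrow> real) \<Rightarrow> nat" where
  "sign_switches N v = card {i. Suc i < N \<and> v i * v (Suc i) < 0}"

lemma sign_switches_Suc:
  "sign_switches (Suc (Suc N)) v = sign_switches (Suc N) v + (if v N * v (Suc N) < 0 then 1 else 0)"
proof -
  have "{i. Suc i < Suc (Suc N) \<and> v i * v (Suc i) < 0} =
      {i. Suc i < Suc N \<and> v i * v (Suc i) < 0} \<union> (if v N * v (Suc N) < 0 then {N} else {})"
    by (auto simp: less_Suc_eq)
  then show ?thesis by (simp add: sign_switches_def card_insert_if)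
qed

text \<open>
  The last point of the alternation has the sign of the last entry, so it can be prolonged at the
  next switch.
\<close>

lemma sign_switches_imp_alternation:
  assumes "\<And>i. i \<le> N \<Longrightarrow> v i \<noteq> 0"
  shows "\<exists>f\<in>increasing_maps (Suc (sign_switches (Suc N) v)) (Suc N).
    alternates_along (sign_switches (Suc N) v) v f \<and> 0 < v (f (sign_switches (Suc N) v)) * v N"
  using assms
proof (induction N)
  case 0
  have "0 < v 0 * v 0" using 0[of 0] by (simp add: zero_less_mult_iff linorder_neq_iff disj_commute)
  then show ?case by (intro bexI[of _ "\<lambda>_. 0"])
    (auto simp: sign_switches_def increasing_maps_def alternates_along_def)
next
  case (Suc N)
  let ?c = "sign_switches (Suc N) v"
  obtain f where f: "f \<in> increasing_maps (Suc ?c) (Suc N)" "alternates_along ?c v f"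
    and pos: "0 < v (f ?c) * v N" using Suc by auto
  have nz: "v N \<noteq> 0" "v (Suc N) \<noteq> 0" using Suc.prems by auto
  show ?case
  proof (cases "v N * v (Suc N) < 0")
    case True
    have "alternates_along (Suc ?c) v (f(Suc ?c := Suc N))"
      using f(2) pos True by (auto simp: alternates_along_def less_Suc_eq mult_less_0_iff zero_less_mult_iff)
    moreover have "f(Suc ?c := Suc N) \<in> increasing_maps (Suc (Suc ?c)) (Suc (Suc N))"
      by (rule increasing_maps_extend[OF f(1)]) auto
    moreover have "0 < v (Suc N) * v (Suc N)"
      using nz by (simp add: zero_less_mult_iff linorder_neq_iff disj_commute)
    ultimately show ?thesis
      unfolding sign_switches_Suc using True
      by (intro bexI[of _ "f(Suc ?c := Suc N)"]) (simp_all del: fun_upd_apply, simp)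
  next
    case False
    then have "0 < v (f ?c) * v (Suc N)" using pos nz by (auto simp: mult_less_0_iff zero_less_mult_iff)
    then show ?thesis
      unfolding sign_switches_Suc using False f increasing_maps_widen[OF f(1), of "Suc (Suc N)"]
      by (intro bexI[of _ f]) auto
  qed
qed

lemma no_switch_imp_same_sign:
  fixes v :: "nat \<Rightarrow> real"
  assumes "\<And>t. i \<le> t \<Longrightarrow> t < i + d \<Longrightarrow> \<not> v t * v (Suc t) < 0" and "\<And>t. t \<le> i + d \<Longrightarrow> v t \<noteq> 0"
  shows "0 < v i * v (i + d)"
  using assms
proof (induction d)
  case 0
  have "v i \<noteq> 0" using 0(2) by simp
  then show ?case by (simp add: zero_less_mult_iff linorder_neq_iff disj_commute)
next
  case (Suc d)
  have "0 < v i * v (i + d)" using Suc by simp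
  moreover have "\<not> v (i + d) * v (Suc (i + d)) < 0" "v (Suc (i + d)) \<noteq> 0"
    using Suc.prems(1)[of "i + d"] Suc.prems(2)[of "Suc (i + d)"] by auto
  ultimately show ?case by (auto simp: mult_less_0_iff zero_less_mult_iff)
qed

text \<open>
  The maximal runs of constant sign are blocks, one more than there are switches.
\<close>

lemma oscillates_imp_sign_switches:
  assumes "\<And>i. i < N \<Longrightarrow> v i \<noteq> 0" and "oscillates k N v"
  shows "k \<le> sign_switches N v"
proof (rule ccontr)
  assume less: "\<not> k \<le> sign_switches N v"
  let ?S = "\<lambda>i. {t. Suc t < N \<and> t < i \<and> v t * v (Suc t) < 0}"
  have fin: "finite (?S i)" for i by (rule finite_subset[of _ "{..<N}"]) auto
  have "\<not> oscillates k N v"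
  proof (rule blocks_imp_not_oscillates[where \<beta> = "\<lambda>i. card (?S i)"])
    show "card (?S i) \<le> card (?S j)" if "i \<le> j" for i j
      using that by (intro card_mono fin) auto
    show "card (?S i) < k" for i
    proof -
      have "card (?S i) \<le> sign_switches N v"
        unfolding sign_switches_def by (rule card_mono) (rule finite_subset[of _ "{..<N}"], auto)
      then show ?thesis using less by simp
    qed
    show "0 \<le> v i * v j" if "i < j" "j < N" "card (?S i) = card (?S j)" for i j
    proof -
      have "?S i \<subseteq> ?S j" using that(1) by auto
      then have eq: "?S i = ?S j" using that(3) by (rule card_subset_eq[OF fin])
      have "\<not> v t * v (Suc t) < 0" if t: "i \<le> t" "t < i + (j - i)" for t
      proof
        assume "v t * v (Suc t) < 0"
        then have "t \<in> ?S j" using t(2) \<open>j < N\<close> \<open>i < j\<close> by simp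
        then have "t \<in> ?S i" by (subst eq)
        then show False using t(1) by simp
      qed
      then have "0 < v i * v (i + (j - i))"
        using assms(1) that by (intro no_switch_imp_same_sign) auto
      then show ?thesis using that by simp
    qed
  qed
  then show False using assms(2) by simp
qed

text \<open>
  Deleting zeros is a change of index along the increasing list of the positions of nonzero
  entries, and alternations only visit such positions. Both sides are false for the zero vector.
\<close>

lemma sign_changes_ge_iff_oscillates:
  assumes "1 \<le> k"
  shows "int k \<le> sign_changes w \<longleftrightarrow> oscillates k (dim_vec w) (\<lambda>i. w $ i)"
proof -
  define n where "n = dim_vec w"
  define ps where "ps = filter (\<lambda>i. w $ i \<noteq> 0) [0..<n]"
  define xs where "xs = filter (\<lambda>x. x \<noteq> 0) (list_of_vec w)"
  have xs: "xs = map (\<lambda>i. w $ i) ps"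
  proof -
    have "list_of_vec w = map (\<lambda>i. w $ i) [0..<n]" 
      by (rule nth_equalityI) (auto simp: n_def list_of_vec_index)
    then show ?thesis by (simp add: xs_def ps_def filter_map o_def)
  qed
  have setps: "set ps = {i. i < n \<and> w $ i \<noteq> 0}" by (auto simp: ps_def)
  have ps_less: "ps ! i < ps ! j" if "i < j" "j < length ps" for i j
    using that sorted_wrt_filter[of "(<)" "[0..<n]" "\<lambda>i. w $ i \<noteq> 0"]
    by (auto simp: ps_def sorted_wrt_iff_nth_less)
  have ps_mem: "ps ! i < n" "w $ (ps ! i) \<noteq> 0" if "i < length ps" for i
    using nth_mem[OF that] setps by auto
  let ?N = "length ps" and ?v = "\<lambda>i. w $ (ps ! i)"
  have nz: "?v i \<noteq> 0" if "i < ?N" for i using ps_mem that by auto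
  have osc: "oscillates k n (\<lambda>i. w $ i) \<longleftrightarrow> oscillates k ?N ?v"
  proof
    assume "oscillates k ?N ?v"
    then obtain f where f: "f \<in> increasing_maps (Suc k) ?N" "alternates_along k ?v f"
      by (auto simp: oscillates_def)
    have "(\<lambda>j. ps ! f j) \<in> increasing_maps (Suc k) n"
      using increasing_mapsD[OF f(1)] ps_less ps_mem by (auto simp: increasing_maps_def)
    then show "oscillates k n (\<lambda>i. w $ i)"
      using f(2) by (auto simp: oscillates_def alternates_along_def)
  next
    assume "oscillates k n (\<lambda>i. w $ i)"
    then obtain f where f: "f \<in> increasing_maps (Suc k) n" "alternates_along k (\<lambda>i. w $ i) f"
      by (auto simp: oscillates_def)
    have nzf: "w $ (f j) \<noteq> 0" if "j < Suc k" for j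
    proof (cases j)
      case 0
      then show ?thesis using f(2) assms by (auto simp: alternates_along_def)
    next
      case (Suc i)
      then show ?thesis using f(2) that by (auto simp: alternates_along_def)
    qed
    have "\<exists>i. i < ?N \<and> ps ! i = f j" if "j < Suc k" for j
    proof -
      have "f j \<in> set ps" using increasing_mapsD(2)[OF f(1) that] nzf[OF that] setps by simp
      then show ?thesis by (auto simp: in_set_conv_nth)
    qed
    then obtain e where e: "\<And>j. j < Suc k \<Longrightarrow> e j < ?N \<and> ps ! e j = f j" by metis
    have "e i < e j" if "i < j" "j < Suc k" for i j
    proof (rule ccontr)
      assume "\<not> e i < e j"
      then have "ps ! e j \<le> ps ! e i"
        using ps_less[of "e j" "e i"] e[of i] that by (cases "e i = e j") auto
      then show False using e[of i] e[of j] increasing_mapsD(1)[OF f(1) that] that by auto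
    qed
    then have "e \<in> increasing_maps (Suc k) ?N" using e by (auto simp: increasing_maps_def)
    moreover have "alternates_along k ?v e" using f(2) e by (auto simp: alternates_along_def)
    ultimately show "oscillates k ?N ?v" by (auto simp: oscillates_def)
  qed
  have switches: "k \<le> sign_switches ?N ?v \<longleftrightarrow> oscillates k ?N ?v"
  proof
    assume le: "k \<le> sign_switches ?N ?v"
    then obtain M where M: "?N = Suc M" using assms by (cases ?N) (auto simp: sign_switches_def)
    obtain f where "f \<in> increasing_maps (Suc (sign_switches ?N ?v)) ?N"
        "alternates_along (sign_switches ?N ?v) ?v f"
      using sign_switches_imp_alternation[of M ?v] nz unfolding M by auto
    then show "oscillates k ?N ?v" using oscillates_mono[OF _ le] by (auto simp: oscillates_def)
  next
    assume "oscillates k ?N ?v"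
    then show "k \<le> sign_switches ?N ?v" by (intro oscillates_imp_sign_switches nz)
  qed
  show ?thesis
  proof (cases "w = 0\<^sub>v n")
    case True
    then have "w $ i = 0" if "i < n" for i using that by (metis index_zero_vec(1))
    then have "\<not> oscillates k n (\<lambda>i. w $ i)"
      using assms by (intro blocks_imp_not_oscillates[where \<beta> = "\<lambda>_. 0"]) auto
    moreover have "sign_changes w = - 1"
      unfolding sign_changes_def n_def[symmetric] by (rule if_P[OF True])
    ultimately show ?thesis unfolding n_def by simp
  next
    case False
    have "sign_changes w = int (sign_switches ?N ?v)"
    proof -
      have "{i. Suc i < length xs \<and> xs ! i * xs ! Suc i < 0} = {i. Suc i < ?N \<and> ?v i * ?v (Suc i) < 0}"
        unfolding xs by (intro Collect_cong) auto
      then show ?thesis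
        unfolding sign_changes_def sign_switches_def n_def[symmetric] xs_def[symmetric] if_not_P[OF False]
        by simp
    qed
    then show ?thesis using switches osc unfolding n_def by simp
  qed
qed

section \<open>Moving between increasing maps by unit steps\<close>

lemma increasing_maps_update:
  assumes "g \<in> increasing_maps k N" and "b < N"
    and "\<And>i. i < s \<Longrightarrow> i < k \<Longrightarrow> g i < b" and "\<And>j. s < j \<Longrightarrow> j < k \<Longrightarrow> b < g j"
  shows "g(s := b) \<in> increasing_maps k N"
proof -
  have "(g(s := b)) i < (g(s := b)) j" if "i < j" "j < k" for i j
    using increasing_mapsD(1)[OF assms(1) that] assms(3)[of i] assms(4)[of j] that by auto
  moreover have "(g(s := b)) i < N" if "i < k" for i
    using increasing_mapsD(2)[OF assms(1) that] assms(2) by auto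
  ultimately show ?thesis by (simp add: increasing_maps_def)
qed

text \<open>
  If some entry lies below its target, the last such entry can be raised: its successor is already
  at or beyond its own, larger target. Otherwise the first entry above its target can be lowered.
\<close>

lemma unit_move_towards:
  assumes g: "g \<in> increasing_maps k N" and T: "T \<in> increasing_maps k N" and ne: "\<exists>t<k. g t \<noteq> T t"
  shows "\<exists>s<k. \<exists>b. (b = Suc (g s) \<or> Suc b = g s) \<and> g(s := b) \<in> increasing_maps k N \<and>
    \<bar>int b - int (T s)\<bar> < \<bar>int (g s) - int (T s)\<bar>"
proof (cases "\<exists>t<k. g t < T t")
  case True
  define s where "s = Max {t. t < k \<and> g t < T t}"
  have fin: "finite {t. t < k \<and> g t < T t}" by simp
  have s: "s < k" "g s < T s"
    using Max_in[OF fin] True unfolding s_def by auto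
  have above: "T j \<le> g j" if "s < j" "j < k" for j
    using Max_ge[OF fin, of j] that unfolding s_def[symmetric] by (auto simp: not_less[symmetric])
  have "g(s := Suc (g s)) \<in> increasing_maps k N"
  proof (rule increasing_maps_update[OF g])
    show "Suc (g s) < N" using s increasing_mapsD(2)[OF T, of s] by simp
    show "g i < Suc (g s)" if "i < s" "i < k" for i using increasing_mapsD(1)[OF g, of i s] s that by simp
    show "Suc (g s) < g j" if "s < j" "j < k" for j
      using above[OF that] increasing_mapsD(1)[OF T that] s by simp
  qed
  then show ?thesis using s by (intro exI[of _ s] conjI exI[of _ "Suc (g s)"]) auto
next
  case False
  define s where "s = Min {t. t < k \<and> T t < g t}"
  have fin: "finite {t. t < k \<and> T t < g t}" by simp
  have s: "s < k" "T s < g s"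
  proof -
    have "{t. t < k \<and> T t < g t} \<noteq> {}" using ne False by (auto simp: neq_iff)
    then show "s < k" "T s < g s" using Min_in[OF fin] unfolding s_def by auto
  qed
  have below: "g i \<le> T i" if "i < s" "i < k" for i
    using Min_le[OF fin, of i] that unfolding s_def[symmetric] by (auto simp: not_less[symmetric])
  have "g(s := g s - 1) \<in> increasing_maps k N"
  proof (rule increasing_maps_update[OF g])
    show "g s - 1 < N" using s increasing_mapsD(2)[OF g, of s] by simp
    show "g i < g s - 1" if "i < s" "i < k" for i
      using below[OF that] increasing_mapsD(1)[OF T, of i s] s that by simp
    show "g s - 1 < g j" if "s < j" "j < k" for j
      using increasing_mapsD(1)[OF g that] by simp
  qed
  then show ?thesis using s by (intro exI[of _ s] conjI exI[of _ "g s - 1"]) auto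
qed

lemma increasing_maps_connected:
  assumes g: "g \<in> increasing_maps k N" and T: "T \<in> increasing_maps k N" and "P g"
    and step: "\<And>g s b. g \<in> increasing_maps k N \<Longrightarrow> P g \<Longrightarrow> s < k \<Longrightarrow> b = Suc (g s) \<or> Suc b = g s \<Longrightarrow>
      g(s := b) \<in> increasing_maps k N \<Longrightarrow> P (g(s := b))"
  shows "\<exists>g'\<in>increasing_maps k N. P g' \<and> (\<forall>t<k. g' t = T t)"
  using g \<open>P g\<close>
proof (induction "\<Sum>t<k. nat \<bar>int (g t) - int (T t)\<bar>" arbitrary: g rule: less_induct)
  case less
  show ?case
  proof (cases "\<exists>t<k. g t \<noteq> T t")
    case True
    then obtain s b where s: "s < k" and b: "b = Suc (g s) \<or> Suc b = g s"
      and inc: "g(s := b) \<in> increasing_maps k N"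
      and closer: "\<bar>int b - int (T s)\<bar> < \<bar>int (g s) - int (T s)\<bar>"
      using unit_move_towards[OF less.prems(1) T True] by (elim exE conjE)
    have "(\<Sum>t<k. nat \<bar>int ((g(s := b)) t) - int (T t)\<bar>) < (\<Sum>t<k. nat \<bar>int (g t) - int (T t)\<bar>)"
      by (rule sum_strict_mono_ex1) (use s closer in auto)
    then show ?thesis
      by (rule less.hyps[OF _ inc step[OF less.prems s b inc]])
  next
    case False
    then show ?thesis using less.prems by (intro bexI[of _ g]) auto
  qed
qed

section \<open>From sign consistency to variation bounding\<close>

lemma alternates_along_signs:
  assumes "alternates_along k v f" and "1 \<le> k" and "j \<le> k"
  shows "0 < (-1) ^ j * v (f j) * v (f 0)"
  using assms(3)
proof (induction j)
  case 0
  have "v (f 0) \<noteq> 0" using assms(1,2) by (auto simp: alternates_along_def)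
  then show ?case by (simp add: zero_less_mult_iff linorder_neq_iff disj_commute)
next
  case (Suc j)
  then have pos: "0 < (-1) ^ j * v (f j) * v (f 0)" by simp
  have "v (f j) * v (f (Suc j)) < 0" using Suc.prems assms(1) by (simp add: alternates_along_def)
  then have "0 < - (v (f j) * v (f (Suc j)))" by simp
  then have "0 < ((-1) ^ j * v (f j) * v (f 0)) * - (v (f j) * v (f (Suc j)))"
    by (rule mult_pos_pos[OF pos])
  also have "\<dots> = ((-1) ^ Suc j * v (f (Suc j)) * v (f 0)) * (v (f j))\<^sup>2"
    by (simp add: power2_eq_square algebra_simps)
  finally show ?case
    using zero_less_mult_pos2[of "(-1) ^ Suc j * v (f (Suc j)) * v (f 0)" "(v (f j))\<^sup>2"] pos
    by (cases "v (f j) = 0") auto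
qed

lemma alternates_along_same_signs:
  assumes "alternates_along k v f" and "\<And>j. j \<le> k \<Longrightarrow> 0 < v (f j) * v' (f j)"
  shows "alternates_along k v' f"
  unfolding alternates_along_def
proof (intro allI impI)
  fix j assume "j < k"
  then have "v (f j) * v (f (Suc j)) < 0" "0 < v (f j) * v' (f j)" "0 < v (f (Suc j)) * v' (f (Suc j))"
    using assms by (auto simp: alternates_along_def)
  then show "v' (f j) * v' (f (Suc j)) < 0"
    by (auto simp: mult_less_0_iff zero_less_mult_iff)
qed

lemma small_perturbation_keeps_signs:
  fixes z v :: "'a \<Rightarrow> real"
  assumes "finite J" and "\<And>j. j \<in> J \<Longrightarrow> z j \<noteq> 0"
  shows "\<exists>\<delta>>0. \<forall>j\<in>J. 0 < z j * (z j + \<delta> * v j)"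
proof -
  have "\<forall>\<^sub>F \<delta> in at_right 0. 0 < z j * (z j + \<delta> * v j)" if "j \<in> J" for j
  proof -
    have "((\<lambda>\<delta>. z j * (z j + \<delta> * v j)) \<longlongrightarrow> z j * (z j + 0 * v j)) (at_right 0)"
      by (intro tendsto_intros)
    moreover have "0 < z j * (z j + 0 * v j)"
      using assms(2)[OF that] by (simp add: zero_less_mult_iff linorder_neq_iff disj_commute)
    ultimately show ?thesis by (rule order_tendstoD(1))
  qed
  then have "\<forall>\<^sub>F \<delta> in at_right 0. \<forall>j\<in>J. 0 < z j * (z j + \<delta> * v j)"
    using assms(1) by (simp add: eventually_ball_finite)
  moreover have "\<forall>\<^sub>F \<delta> in at_right 0. (0::real) < \<delta>" by (simp add: eventually_at_right_less)
  ultimately have "\<forall>\<^sub>F \<delta> in at_right 0. 0 < \<delta> \<and> (\<forall>j\<in>J. 0 < z j * (z j + \<delta> * v j))"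
    by (rule eventually_conj[rotated])
  then show ?thesis using eventually_happens[of _ "at_right (0::real)"] by (auto simp: trivial_limit_at_right_real)
qed

lemma increasing_maps_skip:
  assumes "f \<in> increasing_maps (Suc k) N"
  shows "f \<circ> insert_index i \<in> increasing_maps k N"
proof -
  have "f (insert_index i a) < f (insert_index i b)" if "a < b" "b < k" for a b
    using increasing_mapsD(1)[OF assms] that by (auto simp: insert_index_def)
  moreover have "f (insert_index i a) < N" if "a < k" for a
    using increasing_mapsD(2)[OF assms] that by (auto simp: insert_index_def)
  ultimately show ?thesis by (simp add: increasing_maps_def)
qed

definition add_row :: "nat \<Rightarrow> nat \<Rightarrow> real \<Rightarrow> (nat \<Rightarrow> nat \<Rightarrow> real) \<Rightarrow> nat \<Rightarrow> nat \<Rightarrow> real" where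
  "add_row a b \<epsilon> V = (\<lambda>i j. V i j + (if i = b then \<epsilon> * V a j else 0))"

lemma minor_add_row:
  assumes g: "g \<in> increasing_maps k N" and "s < k" and b: "g s = b"
  shows "minor k (add_row a b \<epsilon> V) g h = minor k V g h + \<epsilon> * minor k V (g(s := a)) h"
proof -
  define M where "M = (\<lambda>(V :: nat \<Rightarrow> nat \<Rightarrow> real) (g :: nat \<Rightarrow> nat). mat k k (\<lambda>(r, s). V (g r) (h s)) :: real mat)"
  have M: "M V g \<in> carrier_mat k k" for V g by (simp add: M_def)
  have minor_M: "minor k V g h = det (M V g)" for V g by (simp add: M_def minor_def)
  have neq: "g r \<noteq> b" if "r < k" "r \<noteq> s" for r
    using increasing_maps_inj[OF g] that assms(2) b by (auto simp: inj_on_def)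
  have skip: "(if i < s then i else Suc i) < k" "(if i < s then i else Suc i) \<noteq> s" if "i < k - 1" for i
    using that assms(2) by auto
  have del: "mat_delete (M (add_row a b \<epsilon> V) g) s j = mat_delete (M V g) s j"
      "mat_delete (M V (g(s := a))) s j = mat_delete (M V g) s j" if "j < k" for j
    unfolding mat_delete_def M_def using neq skip that
    by (intro eq_matI; simp add: add_row_def)+
  have "minor k (add_row a b \<epsilon> V) g h =
      (\<Sum>j<k. (V b (h j) + \<epsilon> * V a (h j)) * cofactor (M V g) s j)"
    unfolding minor_M laplace_expansion_row[OF M \<open>s < k\<close>]
    using assms(2) b del by (intro sum.cong) (auto simp: cofactor_def M_def add_row_def)
  also have "\<dots> = (\<Sum>j<k. V b (h j) * cofactor (M V g) s j) +
      \<epsilon> * (\<Sum>j<k. V a (h j) * cofactor (M V g) s j)"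
    by (simp add: sum_distrib_left sum.distrib algebra_simps)
  also have "(\<Sum>j<k. V b (h j) * cofactor (M V g) s j) = minor k V g h"
    unfolding minor_M laplace_expansion_row[OF M \<open>s < k\<close>]
    using assms(2) b by (intro sum.cong) (auto simp: M_def)
  also have "(\<Sum>j<k. V a (h j) * cofactor (M V g) s j) = minor k V (g(s := a)) h"
    unfolding minor_M laplace_expansion_row[OF M \<open>s < k\<close>]
    using assms(2) del by (intro sum.cong) (auto simp: cofactor_def M_def)
  finally show ?thesis .
qed

lemma minor_repeated_row:
  assumes "i < k" "j < k" "i \<noteq> j" "g i = g j"
  shows "minor k V g h = 0"
  unfolding minor_def using assms by (intro det_identical_rows[of _ k i j] eq_vecI) auto

text \<open>
  Only neighbouring rows are allowed here: replacing \<open>b\<close> by the adjacent row \<open>a\<close> keeps the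
  enumeration increasing unless \<open>a\<close> already occurs, in which case the determinant vanishes. For
  distant rows a permutation sign could appear.
\<close>

lemma add_adjacent_row_minor_ge:
  assumes nonneg: "\<And>g. g \<in> increasing_maps k N \<Longrightarrow> 0 \<le> \<sigma> * minor k V g h"
    and adj: "b = Suc a \<or> Suc b = a" and "a < N" and "0 \<le> \<epsilon>"
    and g: "g \<in> increasing_maps k N"
  shows "\<sigma> * minor k V g h \<le> \<sigma> * minor k (add_row a b \<epsilon> V) g h"
proof (cases "b \<in> g ` {..<k}")
  case False
  then have "g r \<noteq> b" if "r < k" for r using that by auto
  then have "minor k (add_row a b \<epsilon> V) g h = minor k V g h"
    by (intro minor_cong) (auto simp: add_row_def)
  then show ?thesis by simp
next
  case True
  then obtain s where s: "s < k" "g s = b" by auto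
  have "0 \<le> \<sigma> * minor k V (g(s := a)) h"
  proof (cases "a \<in> g ` {..<k}")
    case True
    then obtain t where "t < k" "g t = a" by auto
    then have "minor k V (g(s := a)) h = 0"
      using s adj by (intro minor_repeated_row[of s k t]) auto
    then show ?thesis by simp
  next
    case False
    have ne: "g i \<noteq> a" if "i < k" for i using False that by blast
    have "g(s := a) \<in> increasing_maps k N"
    proof (rule increasing_maps_update[OF g \<open>a < N\<close>])
      show "g i < a" if "i < s" "i < k" for i
        using increasing_mapsD(1)[OF g, of i s] s that adj ne[of i] by auto
      show "a < g j" if "s < j" "j < k" for j
        using increasing_mapsD(1)[OF g, of s j] s that adj ne[of j] by auto
    qed
    then show ?thesis by (rule nonneg)
  qed
  then have "0 \<le> \<epsilon> * (\<sigma> * minor k V (g(s := a)) h)" using assms(4) by simp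
  then show ?thesis unfolding minor_add_row[OF g s] by (simp add: algebra_simps)
qed

text \<open>
  One direction of the Gantmacher-Krein theorem, which characterises the \<open>k\<close>-dimensional subspaces
  without vectors of \<open>k\<close> sign changes by the signs of their maximal minors. The factor \<open>\<sigma>\<close> covers
  both signs at once. The predicate \<open>P g\<close> says that, after suitable row operations, the minor on
  \<open>g\<close> is nonzero while all hypotheses persist; unit steps carry it to the first \<open>k\<close> rows of the
  alternation.
\<close>

lemma same_sign_minors_imp_not_oscillates:
  assumes "1 \<le> k"
    and nonneg: "\<And>g. g \<in> increasing_maps k N \<Longrightarrow> 0 \<le> \<sigma> * minor k V g h"
    and pos: "g0 \<in> increasing_maps k N" "0 < \<sigma> * minor k V g0 h"
  shows "\<not> oscillates k N (\<lambda>i. \<Sum>s<k. V i (h s) * c s)"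
proof
  define y where "y = (\<lambda>(V :: nat \<Rightarrow> nat \<Rightarrow> real) (i :: nat). \<Sum>s<k. V i (h s) * c s)"
  assume "oscillates k N (\<lambda>i. \<Sum>s<k. V i (h s) * c s)"
  then obtain f where f: "f \<in> increasing_maps (Suc k) N" and alt: "alternates_along k (y V) f"
    by (auto simp: oscillates_def y_def)
  define P where "P = (\<lambda>g. \<exists>V. (\<forall>g\<in>increasing_maps k N. 0 \<le> \<sigma> * minor k V g h) \<and>
    alternates_along k (y V) f \<and> 0 < \<sigma> * minor k V g h)"
  have "\<exists>g\<in>increasing_maps k N. P g \<and> (\<forall>t<k. g t = f t)"
  proof (rule increasing_maps_connected[OF pos(1)])
    show "f \<in> increasing_maps k N" using increasing_maps_prefix[OF f] by simp
    show "P g0" unfolding P_def using nonneg alt pos(2) by blast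
  next
    fix g s b
    assume g: "g \<in> increasing_maps k N" and "P g" and s: "s < k"
      and b: "b = Suc (g s) \<or> Suc b = g s" and g': "g(s := b) \<in> increasing_maps k N"
    then obtain W where W: "\<And>g. g \<in> increasing_maps k N \<Longrightarrow> 0 \<le> \<sigma> * minor k W g h"
        "alternates_along k (y W) f" "0 < \<sigma> * minor k W g h"
      unfolding P_def by blast
    let ?a = "g s"
    have nz: "y W (f j) \<noteq> 0" if "j \<le> k" for j
      using alternates_along_signs[OF W(2) assms(1) that] by auto
    obtain \<epsilon> where \<epsilon>: "0 < \<epsilon>" "\<And>i. i \<in> f ` {..k} \<Longrightarrow> 0 < y W i * (y W i + \<epsilon> * y W ?a)"
      using small_perturbation_keeps_signs[of "f ` {..k}" "y W" "\<lambda>_. y W ?a"] nz by auto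
    let ?W = "add_row ?a b \<epsilon> W"
    have ge: "\<sigma> * minor k W g h \<le> \<sigma> * minor k ?W g h" if "g \<in> increasing_maps k N" for g
      using W(1) b increasing_mapsD(2)[OF g s] \<epsilon>(1) that by (intro add_adjacent_row_minor_ge) auto
    have nonneg': "0 \<le> \<sigma> * minor k ?W g h" if "g \<in> increasing_maps k N" for g
      using ge[OF that] W(1)[OF that] by linarith
    have yW: "y ?W i = y W i + (if i = b then \<epsilon> * y W ?a else 0)" for i
      by (simp add: y_def add_row_def sum_distrib_left sum.distrib algebra_simps)
    have "alternates_along k (y ?W) f"
    proof (rule alternates_along_same_signs[OF W(2)])
      fix j assume "j \<le> k"
      then show "0 < y W (f j) * y ?W (f j)"
        using \<epsilon>(2)[of "f j"] nz[of j]
        by (auto simp: yW zero_less_mult_iff linorder_neq_iff disj_commute)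
    qed
    moreover have "0 < \<sigma> * minor k ?W (g(s := b)) h"
    proof -
      have "minor k ?W (g(s := b)) h = minor k W (g(s := b)) h + \<epsilon> * minor k W ((g(s := b))(s := ?a)) h"
        by (rule minor_add_row[OF g' s]) simp
      then have "\<sigma> * minor k ?W (g(s := b)) h = \<sigma> * minor k W (g(s := b)) h + \<epsilon> * (\<sigma> * minor k W g h)"
        by (simp add: algebra_simps)
      then show ?thesis using W(1)[OF g'] mult_pos_pos[OF \<epsilon>(1) W(3)] by linarith
    qed
    ultimately show "P (g(s := b))" unfolding P_def using nonneg' by blast
  qed
  then obtain g W where gf: "\<And>t. t < k \<Longrightarrow> g t = f t"
    and W: "\<And>g. g \<in> increasing_maps k N \<Longrightarrow> 0 \<le> \<sigma> * minor k W g h"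
      "alternates_along k (y W) f" "0 < \<sigma> * minor k W g h"
    unfolding P_def by blast
  let ?t = "\<lambda>i. ((-1) ^ i * y W (f i) * y W (f 0)) * (\<sigma> * minor k W (f \<circ> insert_index i) h)"
  have nn: "0 \<le> ?t i" if "i < Suc k" for i
    using that by (intro mult_nonneg_nonneg[OF less_imp_le]
      alternates_along_signs[OF W(2) assms(1)] W(1)[OF increasing_maps_skip[OF f]]) simp
  have same: "minor k W (f \<circ> insert_index k) h = minor k W g h"
    by (rule minor_cong) (simp add: gf)
  have "0 < ?t k"
    unfolding same by (intro mult_pos_pos[OF alternates_along_signs[OF W(2) assms(1)] W(3)]) simp
  then have "0 < (\<Sum>i<Suc k. ?t i)"
    using nn by (intro sum_pos2[of _ k]) auto
  also have "(\<Sum>i<Suc k. ?t i) = y W (f 0) * \<sigma> *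
      (\<Sum>i<Suc k. (-1) ^ i * y W (f i) * minor k W (f \<circ> insert_index i) h)"
    by (subst sum_distrib_left, rule sum.cong, rule refl, simp)
  also have "\<dots> = 0" unfolding y_def minor_orthogonality by simp
  finally show False by simp
qed

text \<open>
  Multilinearity of the determinant in its columns.
\<close>

lemma minor_column_sums:
  assumes "\<And>s. s < k \<Longrightarrow> finite (B s)"
  shows "minor k (\<lambda>i s. \<Sum>j\<in>B s. w j * A i j) g id =
    (\<Sum>h\<in>PiE {..<k} B. (\<Prod>s<k. w (h s)) * minor k A g h)"
proof -
  have det: "minor k V g h = (\<Sum>p | p permutes {0..<k}. signof p * (\<Prod>s<k. V (g (p s)) (h s)))" for V h
  proof -
    have "(\<Prod>s<k. mat k k (\<lambda>(r, s). V (g r) (h s)) $$ (p s, s)) = (\<Prod>s<k. V (g (p s)) (h s))"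
      if "p permutes {0..<k}" for p
      using permutes_in_image[OF that] by (intro prod.cong) (auto simp: atLeast0LessThan)
    then show ?thesis unfolding minor_def by (subst det_col[of _ k]) auto
  qed
  have "minor k (\<lambda>i s. \<Sum>j\<in>B s. w j * A i j) g id =
      (\<Sum>p | p permutes {0..<k}. signof p * (\<Prod>s<k. \<Sum>j\<in>B s. w j * A (g (p s)) j))"
    by (simp add: det)
  also have "\<dots> = (\<Sum>p | p permutes {0..<k}. \<Sum>h\<in>PiE {..<k} B.
      signof p * (\<Prod>s<k. w (h s) * A (g (p s)) (h s)))"
  proof (rule sum.cong)
    fix p
    have "(\<Prod>s<k. \<Sum>j\<in>B s. w j * A (g (p s)) j) =
        (\<Sum>h\<in>PiE {..<k} B. \<Prod>s<k. w (h s) * A (g (p s)) (h s))"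
      using assms by (intro prod_sum_PiE) auto
    then show "signof p * (\<Prod>s<k. \<Sum>j\<in>B s. w j * A (g (p s)) j) =
        (\<Sum>h\<in>PiE {..<k} B. signof p * (\<Prod>s<k. w (h s) * A (g (p s)) (h s)))"
      by (simp only: sum_distrib_left)
  qed simp
  also have "\<dots> = (\<Sum>h\<in>PiE {..<k} B. \<Sum>p | p permutes {0..<k}.
      signof p * (\<Prod>s<k. w (h s) * A (g (p s)) (h s)))"
    by (rule sum.swap)
  also have "\<dots> = (\<Sum>h\<in>PiE {..<k} B. (\<Prod>s<k. w (h s)) * minor k A g h)"
    by (simp add: det prod.distrib sum_distrib_left mult_ac)
  finally show ?thesis .
qed

definition columns_independent :: "nat \<Rightarrow> nat \<Rightarrow> (nat \<Rightarrow> nat \<Rightarrow> real) \<Rightarrow> (nat \<Rightarrow> nat) \<Rightarrow> bool" where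
  "columns_independent k N A h \<longleftrightarrow>
    (\<forall>c. (\<forall>i<N. (\<Sum>s<k. A i (h s) * c s) = 0) \<longrightarrow> (\<forall>s<k. c s = 0))"

lemma columns_independent_imp_minor:
  assumes "columns_independent k N A h"
  shows "\<exists>g\<in>increasing_maps k N. minor k A g h \<noteq> 0"
proof (rule exists_nonzero_minor)
  fix c assume "\<And>i. i < N \<Longrightarrow> (\<Sum>s<k. A i (h s) * c s) = 0"
  then have "\<forall>i<N. (\<Sum>s<k. A i (h s) * c s) = 0" by (intro allI impI)
  then show "\<forall>s<k. c s = 0"
    by (rule assms[unfolded columns_independent_def, THEN spec, THEN mp])
qed

text \<open>
  Merging the columns of each block of \<open>u\<close> reduces the claim to a matrix with \<open>k\<close> columns. Choices
  of one column per block are automatically increasing, so only the given minors occur in the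
  expansion.
\<close>

lemma sign_consistent_imp_not_oscillates:
  assumes k: "1 \<le> k" "k \<le> m"
    and indep: "\<And>h. h \<in> increasing_maps k m \<Longrightarrow> columns_independent k n A h"
    and nonneg: "\<And>g h. g \<in> increasing_maps k n \<Longrightarrow> h \<in> increasing_maps k m \<Longrightarrow> 0 \<le> \<sigma> * minor k A g h"
    and \<sigma>: "\<sigma> \<noteq> 0" and u: "\<not> oscillates k m u"
  shows "\<not> oscillates k n (\<lambda>i. \<Sum>j<m. A i j * u j)"
proof -
  obtain \<beta> where mono: "\<And>i j. i \<le> j \<Longrightarrow> \<beta> i \<le> \<beta> j" and bound: "\<And>i. i < m \<Longrightarrow> \<beta> i < k"
    and hit: "\<And>s. s < k \<Longrightarrow> \<exists>i<m. \<beta> i = s"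
    and const: "\<And>i j. i < m \<Longrightarrow> j < m \<Longrightarrow> \<beta> i = \<beta> j \<Longrightarrow> 0 \<le> u i * u j"
    using not_oscillates_imp_blocks[OF u k] by metis
  \<comment> \<open>The sign of each block. A block on which \<open>u\<close> vanishes gets sign \<open>0\<close> and weights \<open>1\<close>, which keeps its merged
    column from vanishing.\<close>
  define c :: "nat \<Rightarrow> real" where "c = (\<lambda>s. if \<exists>i<m. \<beta> i = s \<and> 0 < u i then 1
    else if \<exists>i<m. \<beta> i = s \<and> u i < 0 then - 1 else 0)"
  define w where "w = (\<lambda>i. if c (\<beta> i) = 0 then 1 else \<bar>u i\<bar>)"
  define B where "B = (\<lambda>s. {j \<in> {..<m}. \<beta> j = s})"
  define V where "V = (\<lambda>i s. \<Sum>j\<in>B s. w j * A i j)"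
  have w_nonneg: "0 \<le> w i" for i by (simp add: w_def)
  have uc: "u i = c (\<beta> i) * w i" if i: "i < m" for i
  proof (cases "u i" "0::real" rule: linorder_cases)
    case less
    have "\<not> (\<exists>j<m. \<beta> j = \<beta> i \<and> 0 < u j)"
    proof
      assume "\<exists>j<m. \<beta> j = \<beta> i \<and> 0 < u j"
      then obtain j where "j < m" "\<beta> j = \<beta> i" "0 < u j" by blast
      then show False using const[of i j] i mult_neg_pos[OF less, of "u j"] by simp
    qed
    then have "c (\<beta> i) = - 1" using less i by (auto simp: c_def)
    then show ?thesis using less by (simp add: w_def)
  next
    case equal
    then show ?thesis by (simp add: w_def)
  next
    case greater
    then have "c (\<beta> i) = 1" using i by (auto simp: c_def)
    then show ?thesis using greater by (simp add: w_def)
  qed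
  have w_pos: "\<exists>j\<in>B s. 0 < w j" if s: "s < k" for s
  proof (cases "c s = 0")
    case True
    then show ?thesis using hit[OF s] by (auto simp: B_def w_def)
  next
    case False
    then obtain i where i: "i < m" "\<beta> i = s" "u i \<noteq> 0" by (auto simp: c_def split: if_splits)
    then have "0 < w i" by (auto simp: w_def)
    then show ?thesis using i by (auto simp: B_def)
  qed
  have fin: "finite (B s)" for s by (simp add: B_def)
  have inc: "h \<in> increasing_maps k m" if h: "h \<in> PiE {..<k} B" for h
  proof -
    have hs: "h s < m" "\<beta> (h s) = s" if "s < k" for s using h that by (auto simp: B_def)
    have "h i < h j" if "i < j" "j < k" for i j
      using mono[of "h j" "h i"] hs[of i] hs[of j] that by (cases "h i < h j") auto
    then show ?thesis using hs by (auto simp: increasing_maps_def)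
  qed
  have expand: "\<sigma> * minor k V g id = (\<Sum>h\<in>PiE {..<k} B. (\<Prod>s<k. w (h s)) * (\<sigma> * minor k A g h))" for g
    unfolding V_def by (subst minor_column_sums[OF fin]) (simp only: sum_distrib_left mult.left_commute)
  have terms_nonneg: "0 \<le> (\<Prod>s<k. w (h s)) * (\<sigma> * minor k A g h)"
    if "g \<in> increasing_maps k n" "h \<in> PiE {..<k} B" for g h
    using nonneg[OF that(1) inc[OF that(2)]] w_nonneg by (simp add: prod_nonneg)
  have V_nonneg: "0 \<le> \<sigma> * minor k V g id" if "g \<in> increasing_maps k n" for g
    unfolding expand using terms_nonneg[OF that] by (rule sum_nonneg)
  obtain h0 where h0: "\<And>s. s < k \<Longrightarrow> h0 s \<in> B s \<and> 0 < w (h0 s)" using w_pos by metis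
  define h where "h = restrict h0 {..<k}"
  have h: "h \<in> PiE {..<k} B" using h0 by (auto simp: h_def)
  obtain g where g: "g \<in> increasing_maps k n" "minor k A g h \<noteq> 0"
    using columns_independent_imp_minor[OF indep[OF inc[OF h]]] by blast
  have "0 < \<sigma> * minor k A g h"
    using nonneg[OF g(1) inc[OF h]] g(2) \<sigma> by (simp add: less_le)
  moreover have "0 < (\<Prod>s<k. w (h s))" using h0 by (intro prod_pos) (auto simp: h_def)
  ultimately have "0 < \<sigma> * minor k V g id"
    unfolding expand using terms_nonneg[OF g(1)] h fin
    by (intro sum_pos2[of _ h]) (auto intro: finite_PiE)
  then have "\<not> oscillates k n (\<lambda>i. \<Sum>s<k. V i (id s) * c s)"
    by (intro same_sign_minors_imp_not_oscillates[where \<sigma> = \<sigma> and ?g0.0 = g] k V_nonneg g)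
  moreover have "(\<Sum>s<k. V i (id s) * c s) = (\<Sum>j<m. A i j * u j)" for i
  proof -
    have "(\<Sum>s<k. V i (id s) * c s) = (\<Sum>s<k. \<Sum>j\<in>B s. A i j * u j)"
      unfolding V_def id_apply sum_distrib_right
      by (intro sum.cong) (auto simp: B_def uc)
    also have "\<dots> = (\<Sum>j<m. A i j * u j)"
      unfolding B_def using bound by (intro sum.group) auto
    finally show ?thesis .
  qed
  ultimately show ?thesis by simp
qed

section \<open>Minors on a fixed set of columns\<close>

lemma sum_skip:
  fixes F :: "nat \<Rightarrow> 'a::comm_monoid_add"
  assumes "i < Suc k"
  shows "(\<Sum>j<Suc k. F j) = F i + (\<Sum>r<k. F (insert_index i r))"
proof -
  have "insert_index i ` {..<k} = {..<Suc k} - {i}"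
    using insert_index_image[of i k] assms by (simp add: atLeast0LessThan)
  moreover have "inj_on (insert_index i) {..<k}" by (rule insert_index_inj_on)
  ultimately have "(\<Sum>j\<in>{..<Suc k} - {i}. F j) = (\<Sum>r<k. F (insert_index i r))"
    by (metis (no_types, lifting) sum.reindex_cong)
  then show ?thesis using assms by (subst sum.remove[of _ i]) auto
qed

lemma insert_index_surj:
  assumes "j < Suc k" "j \<noteq> i" "i < Suc k"
  obtains r where "r < k" "j = insert_index i r"
proof
  show "delete_index i j < k" using assms by (auto simp: delete_index_def)
  show "j = insert_index i (delete_index i j)" using insert_delete_index[OF assms(2)] by simp
qed

lemma alternating_signs_imp_alternates_along:
  assumes "\<And>j. j \<le> k \<Longrightarrow> 0 < (-1) ^ j * v (f j)"
  shows "alternates_along k v f"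
  unfolding alternates_along_def
proof (intro allI impI)
  fix j assume "j < k"
  then have "0 < ((-1) ^ j * v (f j)) * ((-1) ^ Suc j * v (f (Suc j)))"
    by (intro mult_pos_pos[OF assms assms]) auto
  also have "\<dots> = - (v (f j) * v (f (Suc j))) * ((-1) ^ j * (-1) ^ j)" by simp
  also have "\<dots> = - (v (f j) * v (f (Suc j)))" by (simp flip: power_add)
  finally show "v (f j) * v (f (Suc j)) < 0" by simp
qed

text \<open>
  The values \<open>(-1)\<^sup>j t\<^sub>j\<close> with \<open>t\<^sub>j > 0\<close> are prescribed in all rows but \<open>f a\<close>. The orthogonality
  relation determines the value at \<open>f a\<close>; if \<open>t\<^sub>b\<close> is large, the two minors of opposite sign
  dominate and force the missing value to alternate as well.
\<close>

lemma opposite_minors_imp_oscillates: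
  assumes f: "f \<in> increasing_maps (Suc k) N" and ab: "a < Suc k" "b < Suc k"
    and opp: "minor k V (f \<circ> insert_index a) h * minor k V (f \<circ> insert_index b) h < 0"
  shows "\<exists>c. oscillates k N (\<lambda>i. \<Sum>s<k. V i (h s) * c s)"
proof -
  define p where "p = (\<lambda>j. minor k V (f \<circ> insert_index j) h)"
  have opp: "p a * p b < 0" using opp by (simp add: p_def)
  then have nz: "p a \<noteq> 0" "p b \<noteq> 0" and "a \<noteq> b" by (auto simp: mult_less_0_iff)
  define R where "R = {..<Suc k} - {a} - {b}"
  \<comment> \<open>Large enough for \<open>M \<bar>p b\<bar>\<close> to exceed the contribution of all remaining rows.\<close>
  define M where "M = (1 + (\<Sum>j\<in>R. \<bar>p j\<bar>)) / \<bar>p b\<bar>"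
  define t where "t = (\<lambda>j. if j = b then M else 1)"
  have abs_nonneg: "0 \<le> (\<Sum>j\<in>R. \<bar>p j\<bar>)" by (simp add: sum_nonneg)
  have "0 < 1 + (\<Sum>j\<in>R. \<bar>p j\<bar>)" using abs_nonneg by linarith
  then have M: "0 < M" using nz by (simp add: M_def)
  obtain c where c: "\<forall>r<k. (\<Sum>s<k. V ((f \<circ> insert_index a) r) (h s) * c s) =
      (-1) ^ insert_index a r * t (insert_index a r)"
    using minor_solve[OF nz(1)[unfolded p_def],
        of "\<lambda>r. (-1) ^ insert_index a r * t (insert_index a r)"] by (elim exE)
  define v where "v = (\<lambda>i. \<Sum>s<k. V i (h s) * c s)"
  have v: "v (f j) = (-1) ^ j * t j" if j: "j < Suc k" "j \<noteq> a" for j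
  proof -
    obtain r where "r < k" "j = insert_index a r" using insert_index_surj[OF j ab(1)] .
    then show ?thesis using c by (simp add: v_def)
  qed
  have "0 = (\<Sum>j<Suc k. (-1) ^ j * v (f j) * p j)"
    unfolding v_def p_def minor_orthogonality ..
  also have "\<dots> = (-1) ^ a * v (f a) * p a + (\<Sum>j\<in>{..<Suc k} - {a}. (-1) ^ j * v (f j) * p j)"
    using ab by (subst sum.remove[of _ a]) auto
  also have "(\<Sum>j\<in>{..<Suc k} - {a}. (-1) ^ j * v (f j) * p j) = (\<Sum>j\<in>{..<Suc k} - {a}. t j * p j)"
    by (intro sum.cong) (simp_all add: v flip: power_add mult.assoc)
  also have "\<dots> = M * p b + (\<Sum>j\<in>R. t j * p j)"
    unfolding R_def using ab \<open>a \<noteq> b\<close> by (subst sum.remove[of _ b]) (auto simp: t_def)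
  also have "(\<Sum>j\<in>R. t j * p j) = (\<Sum>j\<in>R. p j)"
    by (intro sum.cong) (auto simp: t_def R_def)
  finally have rel: "(-1) ^ a * v (f a) * p a = - (M * p b + (\<Sum>j\<in>R. p j))" by simp
  have Mb: "M * \<bar>p b\<bar> = 1 + (\<Sum>j\<in>R. \<bar>p j\<bar>)" using nz by (simp add: M_def)
  have "\<bar>\<Sum>j\<in>R. p j\<bar> \<le> (\<Sum>j\<in>R. \<bar>p j\<bar>)" by (rule sum_abs)
  then have bound: "- (\<Sum>j\<in>R. \<bar>p j\<bar>) \<le> (\<Sum>j\<in>R. p j)" "(\<Sum>j\<in>R. p j) \<le> (\<Sum>j\<in>R. \<bar>p j\<bar>)"
    by linarith+
  have va: "0 < (-1) ^ a * v (f a)"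
  proof (cases "0 < p b")
    case True
    then have "p a < 0" using opp by (simp add: mult_less_0_iff)
    moreover have "M * p b = 1 + (\<Sum>j\<in>R. \<bar>p j\<bar>)" using Mb True by simp
    then have "(-1) ^ a * v (f a) * p a < 0" using rel bound by linarith
    ultimately show ?thesis by (simp add: mult_less_0_iff)
  next
    case False
    then have "0 < p a" "p b < 0" using opp by (auto simp: mult_less_0_iff)
    moreover have "M * p b = - (1 + (\<Sum>j\<in>R. \<bar>p j\<bar>))" using Mb \<open>p b < 0\<close> by simp
    then have "0 < (-1) ^ a * v (f a) * p a" using rel bound by linarith
    ultimately show ?thesis by (simp add: zero_less_mult_iff)
  qed
  have "alternates_along k v f"
  proof (rule alternating_signs_imp_alternates_along)
    fix j assume "j \<le> k"
    show "0 < (-1) ^ j * v (f j)"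
    proof (cases "j = a")
      case False
      then have "(-1) ^ j * v (f j) = t j" using v[of j] \<open>j \<le> k\<close> by (simp flip: power_add mult.assoc)
      then show ?thesis using M by (simp add: t_def)
    qed (use va in simp)
  qed
  then show ?thesis using f unfolding v_def oscillates_def by blast
qed

lemma image_skip:
  assumes "f \<in> increasing_maps (Suc k) N" and "i < Suc k"
  shows "(f \<circ> insert_index i) ` {..<k} = f ` {..<Suc k} - {f i}"
proof -
  have "(f \<circ> insert_index i) ` {..<k} = f ` ({..<Suc k} - {i})"
    using insert_index_image[of i k] assms(2) by (simp only: atLeast0LessThan image_comp[symmetric])
  also have "\<dots> = f ` {..<Suc k} - {f i}"
    using increasing_maps_inj[OF assms(1)] assms(2) by (subst inj_on_image_set_diff) auto
  finally show ?thesis .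
qed

text \<open>
  Induction on the size of \<open>g1 - g2\<close>. Basis exchange replaces a row \<open>g1 s\<close> outside of \<open>g2\<close> by a
  row \<open>g2 t\<close> with a nonzero minor; its sign is that of \<open>g1\<close> by the neighbouring case, and it is
  closer to \<open>g2\<close>.
\<close>

lemma not_oscillates_imp_same_sign_minors:
  assumes "\<And>c. \<not> oscillates k N (\<lambda>i. \<Sum>s<k. V i (h s) * c s)"
    and "g1 \<in> increasing_maps k N" "g2 \<in> increasing_maps k N"
    and "0 < minor k V g1 h" "minor k V g2 h < 0"
  shows False
  using assms(2-5)
proof (induction "card (g1 ` {..<k} - g2 ` {..<k})" arbitrary: g1 rule: less_induct)
  case less
  let ?I1 = "g1 ` {..<k}" and ?I2 = "g2 ` {..<k}"
  define v where "v = (\<lambda>c i. \<Sum>s<k. V i (h s) * c s)"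
  have "\<not> ?I1 \<subseteq> ?I2"
  proof
    assume "?I1 \<subseteq> ?I2"
    then have "?I1 = ?I2" using increasing_maps_image(2)[OF less.prems(1)]
        increasing_maps_image(2)[OF less.prems(2)] by (intro card_subset_eq) auto
    then have "minor k V g1 h = minor k V g2 h"
      using increasing_maps_unique[OF less.prems(1,2)] by (intro minor_cong) auto
    then show False using less.prems by simp
  qed
  then obtain s where s: "s < k" "g1 s \<notin> ?I2" by auto
  have nz1: "minor k V g1 h \<noteq> 0" using less.prems(3) by simp
  obtain c0 where c0: "\<forall>r<k. v c0 (g1 r) = (if r = s then 1 else 0)"
    using minor_solve[OF nz1, of "\<lambda>r. if r = s then 1 else 0"] unfolding v_def by (elim exE)
  \<comment> \<open>\<open>c0\<close> spans the kernel of the rows \<open>g1\<close> without \<open>g1 s\<close>, so a row that does not vanish on it can replace \<open>g1 s\<close>.\<close>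
  have "\<exists>t<k. v c0 (g2 t) \<noteq> 0"
  proof (rule ccontr)
    assume "\<not> (\<exists>t<k. v c0 (g2 t) \<noteq> 0)"
    then have z: "(\<Sum>s<k. V (g2 r) (h s) * c0 s) = 0" if "r < k" for r
      using that by (simp add: v_def)
    have nz2: "minor k V g2 h \<noteq> 0" using less.prems(4) by simp
    have "c0 r = 0" if "r < k" for r by (rule minor_nonzeroD[OF nz2 z that])
    then have "v c0 (g1 s) = 0" by (simp add: v_def)
    then show False using c0 s(1) by simp
  qed
  then obtain t where t: "t < k" "v c0 (g2 t) \<noteq> 0" by blast
  have b_notin: "g2 t \<notin> ?I1"
  proof
    assume "g2 t \<in> ?I1"
    then obtain r where "r < k" "g2 t = g1 r" by auto
    then have "r = s" using c0 t(2) by (cases "r = s") auto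
    then show False using s(2) t(1) \<open>g2 t = g1 r\<close> by (metis imageI lessThan_iff)
  qed
  define I where "I = insert (g2 t) ?I1"
  define f where "f = pick I"
  have I: "I \<subseteq> {..<N}" "card I = Suc k"
    using b_notin increasing_maps_image[OF less.prems(1)] increasing_mapsD(2)[OF less.prems(2) t(1)]
    by (auto simp: I_def)
  have f: "f \<in> increasing_maps (Suc k) N" and f_image: "f ` {..<Suc k} = I"
    unfolding f_def using increasing_maps_enumeration[OF I] by auto
  have "g1 s \<in> f ` {..<Suc k}" "g2 t \<in> f ` {..<Suc k}"
    unfolding f_image I_def using s(1) by auto
  then obtain a b where a: "a < Suc k" "f a = g1 s" and b: "b < Suc k" "f b = g2 t"
    by (metis (no_types, lifting) imageE lessThan_iff)
  define g3 where "g3 = f \<circ> insert_index a"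
  have g3: "g3 \<in> increasing_maps k N" unfolding g3_def by (rule increasing_maps_skip[OF f])
  have g3_image: "g3 ` {..<k} = I - {g1 s}" unfolding g3_def image_skip[OF f a(1)] f_image a(2) ..
  have "(f \<circ> insert_index b) ` {..<k} = ?I1"
    unfolding image_skip[OF f b(1)] f_image b(2) I_def using b_notin by auto
  then have g1: "minor k V (f \<circ> insert_index b) h = minor k V g1 h"
    using increasing_maps_unique[OF increasing_maps_skip[OF f] less.prems(1)] by (intro minor_cong) metis
  have ne: "g1 r \<noteq> g1 s" if "r < k" "r \<noteq> s" for r
    using increasing_maps_inj[OF less.prems(1)] that s(1) by (auto simp: inj_on_def)
  have "minor k V g3 h \<noteq> 0"
    unfolding minor_nonzero_iff_injective g3_image
  proof (intro allI impI)
    fix c r assume "\<forall>i\<in>I - {g1 s}. (\<Sum>s<k. V i (h s) * c s) = 0" and r: "r < k"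
    then have c: "v c i = 0" if "i \<in> I - {g1 s}" for i using that by (simp add: v_def)
    define l where "l = v c (g1 s)"
    have lin: "v (\<lambda>s. c s - l * c0 s) i = v c i - l * v c0 i" for i
      by (simp add: v_def right_diff_distrib sum_subtractf sum_distrib_left mult_ac)
    have "v (\<lambda>s. c s - l * c0 s) (g1 r) = 0" if "r < k" for r
      using c0 that c[of "g1 r"] ne[OF that] unfolding lin by (auto simp: I_def l_def)
    then have z: "(\<Sum>s<k. V (g1 r) (h s) * (c s - l * c0 s)) = 0" if "r < k" for r
      using that by (simp only: v_def)
    have cl: "c r - l * c0 r = 0" if "r < k" for r by (rule minor_nonzeroD[OF nz1 z that])
    have "v (\<lambda>s. c s - l * c0 s) (g2 t) = 0" using cl by (simp add: v_def)
    moreover have "g2 t \<noteq> g1 s" using s(2) t(1) by (metis imageI lessThan_iff)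
    then have "v c (g2 t) = 0" by (intro c) (simp add: I_def)
    ultimately have "l = 0" using t(2) unfolding lin by simp
    then show "c r = 0" using cl[OF r] by simp
  qed
  moreover have "\<not> minor k V g3 h < 0"
  proof
    assume "minor k V g3 h < 0"
    then have "minor k V (f \<circ> insert_index a) h * minor k V (f \<circ> insert_index b) h < 0"
      unfolding g1 g3_def using less.prems(3) by (simp add: mult_less_0_iff)
    then show False using opposite_minors_imp_oscillates[OF f a(1) b(1)] assms(1) by blast
  qed
  ultimately have pos: "0 < minor k V g3 h" by simp
  have "g3 ` {..<k} - ?I2 \<subset> ?I1 - ?I2"
    unfolding g3_image I_def using s t(1) by auto
  then have "card (g3 ` {..<k} - ?I2) < card (?I1 - ?I2)"
    by (intro psubset_card_mono) auto
  then show False by (rule less.hyps[OF _ g3 less.prems(2) pos less.prems(4)])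
qed

section \<open>Coefficient vectors on selected columns\<close>

text \<open>
  For increasing \<open>h\<close> at most one summand is nonzero: this is the vector with the coefficients \<open>c\<close>
  at the places \<open>h 0, \<dots>, h (l - 1)\<close> and zeros elsewhere.
\<close>

definition spread :: "nat \<Rightarrow> (nat \<Rightarrow> nat) \<Rightarrow> (nat \<Rightarrow> real) \<Rightarrow> nat \<Rightarrow> real" where
  "spread l h c j = (\<Sum>t<l. if h t = j then c t else 0)"

lemma spread_at:
  assumes "h \<in> increasing_maps l m" and "t < l"
  shows "spread l h c (h t) = c t"
proof -
  have "(if h t' = h t then c t' else 0) = (if t' = t then c t' else 0)" if "t' \<in> {..<l}" for t'
    using increasing_maps_inj[OF assms(1)] assms(2) that by (auto simp: inj_on_def)
  then show ?thesis unfolding spread_def using assms(2) by simp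
qed

lemma spread_outside: "j \<notin> h ` {..<l} \<Longrightarrow> spread l h c j = 0"
  unfolding spread_def by (intro sum.neutral) auto

lemma sum_spread:
  assumes "h \<in> increasing_maps l m"
  shows "(\<Sum>j<m. B j * spread l h c j) = (\<Sum>t<l. B (h t) * c t)"
proof -
  have "(\<Sum>j<m. B j * spread l h c j) = (\<Sum>t<l. \<Sum>j<m. if h t = j then B j * c t else 0)"
    unfolding spread_def sum_distrib_left by (subst sum.swap) (intro sum.cong; simp)
  also have "\<dots> = (\<Sum>t<l. B (h t) * c t)"
    using increasing_mapsD(2)[OF assms] by (intro sum.cong) auto
  finally show ?thesis .
qed

text \<open>
  Block \<open>t\<close> reaches from column \<open>h t\<close> up to the next selected column; because of the truncated
  subtraction, the columns before \<open>h 0\<close> belong to block \<open>0\<close>. So each of the \<open>k\<close> blocks contains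
  exactly one selected column.
\<close>

definition column_block :: "nat \<Rightarrow> (nat \<Rightarrow> nat) \<Rightarrow> nat \<Rightarrow> nat" where
  "column_block k h i = card {t \<in> {..<k}. h t \<le> i} - 1"

lemma column_block_mono: "i \<le> j \<Longrightarrow> column_block k h i \<le> column_block k h j"
  unfolding column_block_def by (intro diff_le_mono card_mono) auto

lemma column_block_less:
  assumes "1 \<le> k"
  shows "column_block k h i < k"
proof -
  have "card {t \<in> {..<k}. h t \<le> i} \<le> card {..<k}" by (intro card_mono) auto
  then show ?thesis using assms by (simp add: column_block_def)
qed

lemma column_block_between:
  assumes "h \<in> increasing_maps k m" and "t < k" and "h t \<le> i" and "\<And>t'. t < t' \<Longrightarrow> t' < k \<Longrightarrow> i < h t'"
  shows "column_block k h i = t"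
proof -
  have "{t' \<in> {..<k}. h t' \<le> i} = {..t}"
  proof (intro Set.set_eqI)
    fix t'
    show "t' \<in> {t' \<in> {..<k}. h t' \<le> i} \<longleftrightarrow> t' \<in> {..t}"
      using increasing_mapsD(1)[OF assms(1), of t' t] assms(2,3) assms(4)[of t']
      by (cases t' t rule: linorder_cases) auto
  qed
  then show ?thesis by (simp add: column_block_def)
qed

lemma column_block_at:
  assumes "h \<in> increasing_maps k m" and "t < k"
  shows "column_block k h (h t) = t"
  by (rule column_block_between[OF assms]) (use increasing_mapsD(1)[OF assms(1)] in auto)

lemma column_block_const_imp_not_oscillates:
  assumes "1 \<le> k" and "\<And>i j. i < j \<Longrightarrow> j < m \<Longrightarrow> column_block k h i = column_block k h j \<Longrightarrow> 0 \<le> u i * u j"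
  shows "\<not> oscillates k m u"
proof (rule blocks_imp_not_oscillates[where \<beta> = "column_block k h"])
  show "column_block k h i \<le> column_block k h j" if "i \<le> j" for i j
    using that by (rule column_block_mono)
  show "column_block k h i < k" for i by (rule column_block_less[OF assms(1)])
  show "0 \<le> u i * u j" if "i < j" "j < m" "column_block k h i = column_block k h j" for i j
    using that by (rule assms(2))
qed

lemma spread_not_oscillates:
  assumes "1 \<le> k" and h: "h \<in> increasing_maps k m"
  shows "\<not> oscillates k m (spread k h c)"
proof (rule column_block_const_imp_not_oscillates[OF assms(1)])
  fix i j assume ij: "i < j" "j < m" "column_block k h i = column_block k h j"
  have "i \<notin> h ` {..<k} \<or> j \<notin> h ` {..<k}"
  proof (rule ccontr)
    assume "\<not> ?thesis"
    then obtain t t' where t: "t < k" "i = h t" "t' < k" "j = h t'" by blast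
    then have "t = t'" using column_block_at[OF h t(1)] column_block_at[OF h t(3)] ij(3) by simp
    then show False using t ij(1) by simp
  qed
  then show "0 \<le> spread k h c i * spread k h c j"
    using spread_outside[of i h k c] spread_outside[of j h k c] by (elim disjE) simp_all
qed

lemma columns_independentD:
  assumes "columns_independent k N A h" and "\<And>i. i < N \<Longrightarrow> (\<Sum>s<k. A i (h s) * c s) = 0" and "s < k"
  shows "c s = 0"
proof -
  have "\<forall>i<N. (\<Sum>s<k. A i (h s) * c s) = 0" using assms(2) by (intro allI impI)
  then have "\<forall>s<k. c s = 0"
    by (rule assms(1)[unfolded columns_independent_def, THEN spec, THEN mp])
  then show ?thesis using assms(3) by simp
qed

text \<open>
  The enumeration of the selected columns together with \<open>h s + 1\<close>, which comes at place \<open>s + 1\<close>.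
\<close>

definition insert_next :: "nat \<Rightarrow> (nat \<Rightarrow> nat) \<Rightarrow> nat \<Rightarrow> nat" where
  "insert_next s h t = (if t \<le> s then h t else if t = Suc s then Suc (h s) else h (t - 1))"

text \<open>
  Omitting place \<open>s + 1\<close> or \<open>s\<close> gives the column sets before and after moving the column \<open>h s\<close> by
  one. The only block with two columns is that of \<open>h s\<close>.
\<close>

lemma insert_next:
  assumes h: "h \<in> increasing_maps k m" and s: "s < k" and h': "h(s := Suc (h s)) \<in> increasing_maps k m"
  shows "insert_next s h \<in> increasing_maps (Suc k) m"
    and "t < k \<Longrightarrow> (insert_next s h \<circ> insert_index (Suc s)) t = h t"
    and "t < k \<Longrightarrow> (insert_next s h \<circ> insert_index s) t = (h(s := Suc (h s))) t"
    and "t < Suc k \<Longrightarrow> column_block k h (insert_next s h t) = (if t \<le> s then t else t - 1)"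
proof -
  have low: "h t < h t'" if "t < t'" "t' < k" for t t' using increasing_mapsD(1)[OF h that] .
  have up: "Suc (h s) < h t" if "s < t" "t < k" for t
    using increasing_mapsD(1)[OF h' that] that by simp
  have bound: "h t < m" if "t < k" for t using increasing_mapsD(2)[OF h that] .
  have "Suc (h s) < m" using increasing_mapsD(2)[OF h' s] by simp
  moreover have "insert_next s h t < insert_next s h t'" if tt: "t < t'" "t' < Suc k" for t t'
  proof -
    consider "t' \<le> s" | "t' = Suc s" | "t \<le> s" "Suc s < t'" | "t = Suc s" "Suc s < t'" | "Suc s < t" "Suc s < t'"
      using tt by linarith
    then show ?thesis
    proof cases
      case 1
      then show ?thesis using low[of t t'] tt s by (simp add: insert_next_def)
    next
      case 2
      then show ?thesis using low[of t s] tt s by (cases "t = s") (auto simp: insert_next_def)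
    next
      case 3
      then show ?thesis using low[of t "t' - 1"] tt s by (simp add: insert_next_def)
    next
      case 4
      then show ?thesis using up[of "t' - 1"] tt s by (simp add: insert_next_def)
    next
      case 5
      then show ?thesis using low[of "t - 1" "t' - 1"] tt by (simp add: insert_next_def)
    qed
  qed
  ultimately show "insert_next s h \<in> increasing_maps (Suc k) m"
    using bound s by (auto simp: increasing_maps_def insert_next_def)
  show "(insert_next s h \<circ> insert_index (Suc s)) t = h t" if "t < k"
    by (auto simp: insert_next_def insert_index_def)
  show "(insert_next s h \<circ> insert_index s) t = (h(s := Suc (h s))) t" if "t < k"
    by (auto simp: insert_next_def insert_index_def)
  show "column_block k h (insert_next s h t) = (if t \<le> s then t else t - 1)" if t: "t < Suc k"
  proof -
    consider "t \<le> s" | "t = Suc s" | "Suc s < t" by linarith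
    then show ?thesis
    proof cases
      case 1
      then show ?thesis using column_block_at[OF h, of t] s by (simp add: insert_next_def)
    next
      case 2
      then show ?thesis using column_block_between[OF h s, of "Suc (h s)"] up by (simp add: insert_next_def)
    next
      case 3
      then show ?thesis using column_block_at[OF h, of "t - 1"] t by (simp add: insert_next_def)
    qed
  qed
qed

lemma alternating_values_attained:
  assumes "minor k A f H \<noteq> 0"
  obtains v where "\<And>i. i < k \<Longrightarrow> (\<Sum>t<k. A (f i) (H t) * v t) = (-1) ^ i"
  using minor_solve[OF assms, of "\<lambda>i. (-1) ^ i"] by blast

section \<open>Comparing neighbouring sets of columns\<close>

text \<open>
  By the independence of any \<open>k\<close> columns, no entry of a nonzero kernel vector on \<open>k + 1\<close> columns
  vanishes. On suitable \<open>k\<close> rows the kernel is a line, spanned by the vector \<open>q\<close> of signed minors;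
  so \<open>z\<close> is proportional to \<open>q\<close>, and weakly opposite minors at neighbouring places mean weakly
  equal signs in \<open>q\<close>.
\<close>

lemma adjacent_kernel_signs:
  assumes H: "H \<in> increasing_maps (Suc k) m" and s: "Suc s < Suc k"
    and indep: "\<And>h. h \<in> increasing_maps k m \<Longrightarrow> columns_independent k n A h"
    and z: "\<And>i. i < n \<Longrightarrow> (\<Sum>t<Suc k. A i (H t) * z t) = 0" and nz: "t0 < Suc k" "z t0 \<noteq> 0"
    and opp: "\<And>g. g \<in> increasing_maps k n \<Longrightarrow>
      minor k A g (H \<circ> insert_index s) * minor k A g (H \<circ> insert_index (Suc s)) \<le> 0"
  shows "t < Suc k \<Longrightarrow> z t \<noteq> 0" and "0 < z s * z (Suc s)"
proof -
  show zt: "z t \<noteq> 0" if t: "t < Suc k" for t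
  proof
    assume zero: "z t = 0"
    have "(\<Sum>r<k. A i ((H \<circ> insert_index t) r) * (z \<circ> insert_index t) r) = 0" if "i < n" for i
      using z[OF that] zero unfolding sum_skip[OF t] by simp
    then have zr: "(z \<circ> insert_index t) r = 0" if "r < k" for r
      by (rule columns_independentD[OF indep[OF increasing_maps_skip[OF H]] _ that])
    show False
    proof (cases "t0 = t")
      case False
      obtain r where "r < k" "t0 = insert_index t r" using insert_index_surj[OF nz(1) False t] .
      then show False using zr nz(2) by simp
    qed (use zero nz in simp)
  qed
  let ?h = "H \<circ> insert_index (Suc s)"
  obtain g where g: "g \<in> increasing_maps k n" "minor k A g ?h \<noteq> 0"
    using columns_independent_imp_minor[OF indep[OF increasing_maps_skip[OF H]]] by blast
  \<comment> \<open>The orthogonality relation for the transposed matrix puts \<open>q\<close> into the kernel of the rows \<open>g\<close>.\<close>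
  define q where "q = (\<lambda>j. (-1) ^ j * minor k A g (H \<circ> insert_index j))"
  have q: "(\<Sum>j<Suc k. A (g r) (H j) * q j) = 0" if r: "r < k" for r
  proof -
    have "(\<Sum>t<k. A (g t) (H j) * (if t = r then 1 else 0)) = A (g r) (H j)" for j
      using r by (simp add: if_distrib cong: if_cong)
    then have "(\<Sum>j<Suc k. (-1) ^ j * A (g r) (H j) * minor k (\<lambda>i j. A j i) (H \<circ> insert_index j) g) = 0"
      using minor_orthogonality[where k = k and A = "\<lambda>i j. A j i" and f = H and h = g
          and c = "\<lambda>t. if t = r then 1 else 0"] by (simp only:)
    then show ?thesis
      unfolding q_def minor_transpose[of k A g] by (simp only: mult_ac)
  qed
  define e where "e = (\<lambda>t. z t * q (Suc s) - z (Suc s) * q t)"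
  have "(\<Sum>r'<k. A (g r) (?h r') * (e \<circ> insert_index (Suc s)) r') = 0" if r: "r < k" for r
  proof -
    have "(\<Sum>t<Suc k. A (g r) (H t) * e t) =
        q (Suc s) * (\<Sum>t<Suc k. A (g r) (H t) * z t) - z (Suc s) * (\<Sum>t<Suc k. A (g r) (H t) * q t)"
      unfolding e_def right_diff_distrib sum_subtractf sum_distrib_left
      by (intro arg_cong2[of _ _ _ _ "(-)"] sum.cong refl) simp_all
    also have "\<dots> = 0" using q[OF r] z[of "g r"] increasing_mapsD(2)[OF g(1) r] by simp
    finally show ?thesis unfolding sum_skip[OF s] by (simp add: e_def)
  qed
  then have er: "(e \<circ> insert_index (Suc s)) r = 0" if "r < k" for r
    by (rule minor_nonzeroD[OF g(2) _ that])
  have "e s = 0" using er[of s] s by simp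
  then have proportional: "z s * q (Suc s) = z (Suc s) * q s" by (simp add: e_def)
  have "q s * q (Suc s) = - (minor k A g (H \<circ> insert_index s) * minor k A g ?h)"
    by (simp add: q_def)
  then have "0 \<le> q s * q (Suc s)" using opp[OF g(1)] by simp
  then have "0 \<le> (z (Suc s))\<^sup>2 * (q s * q (Suc s))"
    by (rule mult_nonneg_nonneg[OF zero_le_power2])
  also have "\<dots> = (z s * z (Suc s)) * (q (Suc s))\<^sup>2"
    using proportional by (simp add: power2_eq_square)
  finally have "0 \<le> z s * z (Suc s)" using g(2) by (simp add: zero_le_mult_iff q_def)
  then show "0 < z s * z (Suc s)" using zt[of s] zt[of "Suc s"] s by (simp add: less_le)
qed

text \<open>
  In both cases a vector without \<open>k\<close> sign changes is produced whose image has them. That it has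
  none is seen from \<open>column_block k h\<close>: the columns \<open>h s\<close> and \<open>h s + 1\<close> share a block, so equal
  signs there save one change.
\<close>

lemma opposite_adjacent_columns_contradiction:
  assumes k: "1 \<le> k"
    and indep: "\<And>h. h \<in> increasing_maps k m \<Longrightarrow> columns_independent k n A h"
    and ext: "\<And>h. h \<in> increasing_maps k m \<Longrightarrow> \<exists>L\<in>increasing_maps (Suc k) m.
      h ` {..<k} \<subseteq> L ` {..<Suc k} \<and> columns_independent (Suc k) n A L"
    and vb: "\<And>u. \<not> oscillates k m u \<Longrightarrow> \<not> oscillates k n (\<lambda>i. \<Sum>j<m. A i j * u j)"
    and h: "h \<in> increasing_maps k m" and s: "s < k"
    and h': "h(s := Suc (h s)) \<in> increasing_maps k m"
    and \<sigma>: "\<sigma> \<noteq> 0" and pos: "\<And>g. g \<in> increasing_maps k n \<Longrightarrow> 0 \<le> \<sigma> * minor k A g h"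
    and neg: "\<And>g. g \<in> increasing_maps k n \<Longrightarrow> \<sigma> * minor k A g (h(s := Suc (h s))) \<le> 0"
  shows False
proof -
  define H where "H = insert_next s h"
  note H = insert_next(1)[OF h s h', folded H_def]
  have minor_s: "minor k A g (H \<circ> insert_index s) = minor k A g (h(s := Suc (h s)))" for g
    by (rule minor_cong) (simp only: insert_next(3)[OF h s h', folded H_def])
  have minor_Suc_s: "minor k A g (H \<circ> insert_index (Suc s)) = minor k A g h" for g
    by (rule minor_cong) (simp only: insert_next(2)[OF h s h', folded H_def])
  have block_H: "column_block k h (H t) = (if t \<le> s then t else t - 1)" if "t < Suc k" for t
    using insert_next(4)[OF h s h' that] by (simp add: H_def)
  have same_block: "t = t' \<or> {t, t'} = {s, Suc s}"
    if "t < Suc k" "t' < Suc k" "column_block k h (H t) = column_block k h (H t')" for t t'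
    using that block_H[of t] block_H[of t'] by (auto split: if_splits)
  show False
  proof (cases "\<exists>f\<in>increasing_maps (Suc k) n. minor (Suc k) A f H \<noteq> 0")
    case True
    then obtain f where f: "f \<in> increasing_maps (Suc k) n" "minor (Suc k) A f H \<noteq> 0" by blast
    obtain u where u: "\<And>i. i < Suc k \<Longrightarrow> (\<Sum>t<Suc k. A (f i) (H t) * u t) = (-1) ^ i"
      using alternating_values_attained[OF f(2)] by blast
    \<comment> \<open>By Cramer's rule and the alternating right-hand side, \<open>D * u j\<close> is up to the sign \<open>(-1)\<^sup>j\<close> a plain sum of minors that omit
      column \<open>j\<close>.\<close>
    define D where "D = minor (Suc k) A f H"
    define S where "S = (\<lambda>j. \<Sum>i<Suc k. \<sigma> * minor k A (f \<circ> insert_index i) (H \<circ> insert_index j))"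
    have Du: "\<sigma> * D * u j = (-1) ^ j * S j" if j: "j < Suc k" for j
    proof -
      have "D * u j = (\<Sum>i<Suc k. (-1) ^ (i + j) * (-1) ^ i *
          minor k A (f \<circ> insert_index i) (H \<circ> insert_index j))"
        unfolding D_def by (rule minor_Cramer[where k = k and A = A and f = f and H = H and u = u
              and y = "\<lambda>i. (-1) ^ i", OF _ j]) (rule u)
      also have "\<dots> = (-1) ^ j * (\<Sum>i<Suc k. minor k A (f \<circ> insert_index i) (H \<circ> insert_index j))"
        unfolding sum_distrib_left
        by (intro sum.cong refl) (simp add: power_add flip: power_mult_distrib)
      finally have "\<sigma> * (D * u j) = \<sigma> * ((-1) ^ j *
          (\<Sum>i<Suc k. minor k A (f \<circ> insert_index i) (H \<circ> insert_index j)))" by (simp only:)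
      also have "\<dots> = (-1) ^ j * S j" unfolding S_def sum_distrib_left[symmetric] by (rule mult.left_commute)
      finally show ?thesis by (simp only: mult.assoc)
    qed
    have "S s \<le> 0" unfolding S_def minor_s
      by (intro sum_nonpos neg increasing_maps_skip[OF f(1)])
    moreover have "0 \<le> S (Suc s)" unfolding S_def minor_Suc_s
      by (intro sum_nonneg pos increasing_maps_skip[OF f(1)])
    ultimately have "S s * S (Suc s) \<le> 0" by (rule mult_nonpos_nonneg)
    moreover have "(\<sigma> * D)\<^sup>2 * (u s * u (Suc s)) = (\<sigma> * D * u s) * (\<sigma> * D * u (Suc s))"
      by (simp add: power2_eq_square)
    then have "(\<sigma> * D)\<^sup>2 * (u s * u (Suc s)) = - (S s * S (Suc s))"
      using Du[of s] Du[of "Suc s"] s by (simp flip: power_add mult.assoc)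
    ultimately have "0 \<le> (\<sigma> * D)\<^sup>2 * (u s * u (Suc s))" by simp
    then have us: "0 \<le> u s * u (Suc s)" using \<sigma> f(2) by (simp add: zero_le_mult_iff D_def)
    have "\<not> oscillates k m (spread (Suc k) H u)"
    proof (rule column_block_const_imp_not_oscillates[OF k])
      fix i j assume ij: "i < j" "j < m" "column_block k h i = column_block k h j"
      show "0 \<le> spread (Suc k) H u i * spread (Suc k) H u j"
      proof (cases "i \<in> H ` {..<Suc k} \<and> j \<in> H ` {..<Suc k}")
        case True
        then obtain t t' where t: "t < Suc k" "i = H t" "t' < Suc k" "j = H t'" by blast
        then have "{t, t'} = {s, Suc s}" using same_block[of t t'] ij by auto
        then have "u t * u t' = u s * u (Suc s)" by (auto simp: doubleton_eq_iff)
        then show ?thesis using us t spread_at[OF H] by simp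
      next
        case False
        then show ?thesis using spread_outside[of i H "Suc k" u] spread_outside[of j H "Suc k" u] by auto
      qed
    qed
    then have "\<not> oscillates k n (\<lambda>i. \<Sum>t<Suc k. A i (H t) * u t)"
      using vb[of "spread (Suc k) H u"] unfolding sum_spread[OF H] by blast
    moreover have "alternates_along k (\<lambda>i. \<Sum>t<Suc k. A i (H t) * u t) f"
      by (rule alternating_signs_imp_alternates_along) (simp add: u del: sum.lessThan_Suc flip: power_add)
    ultimately show False using f(1) by (auto simp: oscillates_def)
  next
    case False
    then have "\<not> columns_independent (Suc k) n A H" using columns_independent_imp_minor by blast
    then obtain z t0 where z: "\<And>i. i < n \<Longrightarrow> (\<Sum>t<Suc k. A i (H t) * z t) = 0"
        and nz: "t0 < Suc k" "z t0 \<noteq> 0"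
      unfolding columns_independent_def by blast
    have opp: "minor k A g (H \<circ> insert_index s) * minor k A g (H \<circ> insert_index (Suc s)) \<le> 0"
      if "g \<in> increasing_maps k n" for g
    proof -
      have "(\<sigma> * minor k A g (h(s := Suc (h s)))) * (\<sigma> * minor k A g h) \<le> 0"
        by (rule mult_nonpos_nonneg[OF neg[OF that] pos[OF that]])
      then have "\<sigma>\<^sup>2 * (minor k A g (h(s := Suc (h s))) * minor k A g h) \<le> 0"
        by (simp add: power2_eq_square mult_ac)
      then show ?thesis unfolding minor_s minor_Suc_s using \<sigma> by (simp add: mult_le_0_iff)
    qed
    have zt: "z t \<noteq> 0" if "t < Suc k" for t
      by (rule adjacent_kernel_signs(1)[OF H _ indep z nz opp that]) (use s in simp)
    have zs: "0 < z s * z (Suc s)"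
      by (rule adjacent_kernel_signs(2)[OF H _ indep z nz opp]) (use s in simp)
    obtain L where L: "L \<in> increasing_maps (Suc k) m" "h ` {..<k} \<subseteq> L ` {..<Suc k}"
        "columns_independent (Suc k) n A L"
      using ext[OF h] by blast
    obtain f where f: "f \<in> increasing_maps (Suc k) n" "minor (Suc k) A f L \<noteq> 0"
      using columns_independent_imp_minor[OF L(3)] by blast
    obtain v where v: "\<And>i. i < Suc k \<Longrightarrow> (\<Sum>t<Suc k. A (f i) (L t) * v t) = (-1) ^ i"
      using alternating_values_attained[OF f(2)] by blast
    have "card (L ` {..<Suc k} - h ` {..<k}) = 1"
      using L(2) increasing_maps_image(2)[OF L(1)] increasing_maps_image(2)[OF h]
      by (subst card_Diff_subset) auto
    then obtain l where l: "L ` {..<Suc k} - h ` {..<k} = {l}" by (rule card_1_singletonE)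
    \<comment> \<open>\<open>\<zeta> p\<close> is the sign that the perturbed vector has to have throughout the block of \<open>p\<close>. Only the new column \<open>l\<close>
      can violate it, and \<open>\<tau>\<close> orients \<open>v\<close> so that it does not.\<close>
    define \<zeta> where "\<zeta> = (\<lambda>p. spread (Suc k) H z (h (column_block k h p)))"
    define \<tau> :: real where "\<tau> = (if 0 \<le> spread (Suc k) L v l * \<zeta> l then 1 else - 1)"
    have \<tau>: "\<tau> \<noteq> 0" "0 \<le> \<tau> * spread (Suc k) L v l * \<zeta> l" by (auto simp: \<tau>_def)
    have "spread (Suc k) H z p \<noteq> 0" if p: "p \<in> H ` {..<Suc k}" for p
    proof -
      obtain t where t: "t < Suc k" "p = H t" using p by (elim imageE) (simp only: lessThan_iff)
      show ?thesis unfolding t(2) spread_at[OF H t(1)] by (rule zt[OF t(1)])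
    qed
    then have "\<exists>\<delta>>0. \<forall>p\<in>H ` {..<Suc k}.
        0 < spread (Suc k) H z p * (spread (Suc k) H z p + \<delta> * (\<tau> * spread (Suc k) L v p))"
      by (rule small_perturbation_keeps_signs[OF finite_imageI[OF finite_lessThan]])
    then obtain \<delta> where \<delta>: "0 < \<delta>" "\<forall>p\<in>H ` {..<Suc k}.
        0 < spread (Suc k) H z p * (spread (Suc k) H z p + \<delta> * (\<tau> * spread (Suc k) L v p))"
      by (elim exE conjE)
    define u where "u = (\<lambda>p. spread (Suc k) H z p + \<delta> * (\<tau> * spread (Suc k) L v p))"
    have h_in_H: "h t \<in> H ` {..<Suc k}" if "t < k" for t
    proof (cases "t \<le> s")
      case True
      then show ?thesis using that by (intro image_eqI[of _ _ t]) (auto simp: H_def insert_next_def)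
    next
      case False
      then show ?thesis using that by (intro image_eqI[of _ _ "Suc t"]) (auto simp: H_def insert_next_def)
    qed
    have \<zeta>_same: "0 < spread (Suc k) H z p * \<zeta> p" if p: "p \<in> H ` {..<Suc k}" for p
    proof -
      obtain t where t: "t < Suc k" "p = H t" using p by auto
      let ?b = "column_block k h p"
      have b: "?b < k" by (rule column_block_less[OF k])
      obtain t' where t': "t' < Suc k" "h ?b = H t'" using h_in_H[OF b] by auto
      have "column_block k h (H t') = column_block k h (H t)"
        using column_block_at[OF h b] t t' by simp
      then have "t' = t \<or> {t', t} = {s, Suc s}" using same_block t t' by simp
      then have "0 < z t * z t'"
      proof
        assume "t' = t"
        then show ?thesis using zt[OF t(1)] by (simp add: zero_less_mult_iff linorder_neq_iff disj_commute)
      next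
        assume "{t', t} = {s, Suc s}"
        then have "z t * z t' = z s * z (Suc s)" by (auto simp: doubleton_eq_iff)
        then show ?thesis using zs by simp
      qed
      then show ?thesis using t t' spread_at[OF H] by (simp add: \<zeta>_def)
    qed
    have u\<zeta>: "0 \<le> u p * \<zeta> p" for p
    proof (cases "p \<in> H ` {..<Suc k}")
      case True
      then show ?thesis using bspec[OF \<delta>(2) True] \<zeta>_same[OF True]
        by (auto simp: u_def zero_less_mult_iff zero_le_mult_iff)
    next
      case False
      then have zp: "spread (Suc k) H z p = 0" by (rule spread_outside)
      show ?thesis
      proof (cases "p = l")
        case True
        then show ?thesis using zp \<tau>(2) \<delta>(1) by (simp add: u_def mult.assoc)
      next
        case F: False
        have "p \<notin> h ` {..<k}" using False h_in_H by auto
        then have "p \<notin> L ` {..<Suc k}" using l F by auto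
        then show ?thesis using zp spread_outside[of p L "Suc k" v] by (simp add: u_def)
      qed
    qed
    have "\<not> oscillates k m u"
    proof (rule column_block_const_imp_not_oscillates[OF k])
      fix i j assume ij: "i < j" "j < m" "column_block k h i = column_block k h j"
      then have eq: "\<zeta> i = \<zeta> j" by (simp add: \<zeta>_def)
      have "h (column_block k h j) \<in> H ` {..<Suc k}" by (rule h_in_H[OF column_block_less[OF k]])
      then have "\<zeta> j \<noteq> 0" unfolding \<zeta>_def using spread_at[OF H] zt by auto
      moreover have "0 \<le> (u i * \<zeta> i) * (u j * \<zeta> j)" by (intro mult_nonneg_nonneg u\<zeta>)
      then have "0 \<le> (u i * u j) * (\<zeta> j)\<^sup>2" by (simp add: eq power2_eq_square mult_ac)
      ultimately show "0 \<le> u i * u j" by (simp add: zero_le_mult_iff)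
    qed
    then have no: "\<not> oscillates k n (\<lambda>i. \<Sum>j<m. A i j * u j)" by (rule vb)
    have Au: "(\<Sum>j<m. A i j * u j) = \<delta> * \<tau> * (\<Sum>t<Suc k. A i (L t) * v t)" if "i < n" for i
    proof -
      have "(\<Sum>j<m. A i j * u j) = (\<Sum>j<m. A i j * spread (Suc k) H z j) +
          \<delta> * \<tau> * (\<Sum>j<m. A i j * spread (Suc k) L v j)"
        unfolding sum_distrib_left sum.distrib[symmetric] by (simp add: u_def algebra_simps)
      then show ?thesis unfolding sum_spread[OF H] sum_spread[OF L(1)] z[OF that] by simp
    qed
    have "alternates_along k (\<lambda>i. \<Sum>j<m. A i j * u j) f"
      unfolding alternates_along_def
    proof (intro allI impI)
      fix i assume i: "i < k"
      have "f i < n" "f (Suc i) < n" using increasing_mapsD(2)[OF f(1)] i by auto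
      then have "(\<Sum>j<m. A (f i) j * u j) * (\<Sum>j<m. A (f (Suc i)) j * u j) =
          (\<delta> * \<tau> * (-1) ^ i) * (\<delta> * \<tau> * (-1) ^ Suc i)"
        using Au v[of i] v[of "Suc i"] i by (simp del: sum.lessThan_Suc)
      also have "\<dots> = - ((\<delta> * \<tau>)\<^sup>2 * ((-1) ^ i * (-1) ^ i))"
        by (simp add: power2_eq_square mult_ac)
      also have "\<dots> = - ((\<delta> * \<tau>)\<^sup>2)" by (simp flip: power_add)
      also have "\<dots> < 0" using \<delta>(1) \<tau>(1) by simp
      finally show "(\<Sum>j<m. A (f i) j * u j) * (\<Sum>j<m. A (f (Suc i)) j * u j) < 0" .
    qed
    then show False using no f(1) by (auto simp: oscillates_def)
  qed
qed

section \<open>Translation to matrices and the theorem\<close>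

text \<open>
  Each column set has a sign by \<open>not_oscillates_imp_same_sign_minors\<close>; unit moves, in either
  direction, cannot change it, and they connect all column sets.
\<close>

lemma not_oscillates_imp_sign_consistent:
  assumes k: "1 \<le> k"
    and indep: "\<And>h. h \<in> increasing_maps k m \<Longrightarrow> columns_independent k n A h"
    and ext: "\<And>h. h \<in> increasing_maps k m \<Longrightarrow> \<exists>L\<in>increasing_maps (Suc k) m.
      h ` {..<k} \<subseteq> L ` {..<Suc k} \<and> columns_independent (Suc k) n A L"
    and vb: "\<And>u. \<not> oscillates k m u \<Longrightarrow> \<not> oscillates k n (\<lambda>i. \<Sum>j<m. A i j * u j)"
  obtains \<sigma> :: real where "\<sigma> \<noteq> 0"
    and "\<And>g h. g \<in> increasing_maps k n \<Longrightarrow> h \<in> increasing_maps k m \<Longrightarrow> 0 \<le> \<sigma> * minor k A g h"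
proof (cases "\<exists>h0. h0 \<in> increasing_maps k m")
  case False
  then show thesis using that[of 1] by auto
next
  case True
  then obtain h0 where h0: "h0 \<in> increasing_maps k m" by blast
  have fixed: "(\<forall>g\<in>increasing_maps k n. 0 \<le> \<sigma> * minor k A g h) \<or> (\<forall>g\<in>increasing_maps k n. \<sigma> * minor k A g h \<le> 0)"
    if h: "h \<in> increasing_maps k m" for h and \<sigma> :: real
  proof -
    have "\<not> oscillates k n (\<lambda>i. \<Sum>s<k. A i (h s) * c s)" for c
      using vb[OF spread_not_oscillates[OF k h, of c]] sum_spread[OF h] by simp
    then have "(\<forall>g\<in>increasing_maps k n. 0 \<le> minor k A g h) \<or> (\<forall>g\<in>increasing_maps k n. minor k A g h \<le> 0)"
      using not_oscillates_imp_same_sign_minors[of k n A h] by (meson not_le)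
    then show ?thesis by (cases "0 \<le> \<sigma>") (auto simp: zero_le_mult_iff mult_le_0_iff)
  qed
  define P where "P = (\<lambda>\<sigma> h. \<forall>g\<in>increasing_maps k n. 0 \<le> \<sigma> * minor k A g h)"
  obtain \<sigma> :: real where \<sigma>: "\<sigma> \<noteq> 0" "P \<sigma> h0"
  proof (cases "P 1 h0")
    case True
    then show thesis using that[of 1] by simp
  next
    case False
    then have "P (- 1) h0" using fixed[OF h0, of 1] by (auto simp: P_def)
    then show thesis using that[of "- 1"] by simp
  qed
  show thesis
  proof (rule that[OF \<sigma>(1)])
    fix g T assume g: "g \<in> increasing_maps k n" and T: "T \<in> increasing_maps k m"
    have "\<exists>h\<in>increasing_maps k m. P \<sigma> h \<and> (\<forall>t<k. h t = T t)"
    proof (rule increasing_maps_connected[where P = "P \<sigma>", OF h0 T \<sigma>(2)])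
      fix h s b
      assume h: "h \<in> increasing_maps k m" and Ph: "P \<sigma> h" and s: "s < k"
        and b: "b = Suc (h s) \<or> Suc b = h s" and h': "h(s := b) \<in> increasing_maps k m"
      show "P \<sigma> (h(s := b))"
      proof (rule ccontr)
        assume "\<not> P \<sigma> (h(s := b))"
        then have neg: "\<And>g. g \<in> increasing_maps k n \<Longrightarrow> \<sigma> * minor k A g (h(s := b)) \<le> 0"
          using fixed[OF h', of \<sigma>] unfolding P_def by blast
        have pos: "\<And>g. g \<in> increasing_maps k n \<Longrightarrow> 0 \<le> \<sigma> * minor k A g h"
          using Ph unfolding P_def by blast
        show False
        proof (cases "b = Suc (h s)")
          case True
          show False
            by (rule opposite_adjacent_columns_contradiction[OF k indep ext vb h s h'[unfolded True]
                  \<sigma>(1) pos neg[unfolded True]])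
        next
          case False
          then have undo: "(h(s := b))(s := Suc ((h(s := b)) s)) = h" using b by auto
          have "- \<sigma> \<noteq> 0" using \<sigma>(1) by simp
          show False
          proof (rule opposite_adjacent_columns_contradiction[OF k indep ext vb h' s _ \<open>- \<sigma> \<noteq> 0\<close>])
            show "(h(s := b))(s := Suc ((h(s := b)) s)) \<in> increasing_maps k m" unfolding undo by (rule h)
            show "0 \<le> - \<sigma> * minor k A g (h(s := b))" if "g \<in> increasing_maps k n" for g
              using neg[OF that] by simp
            show "- \<sigma> * minor k A g ((h(s := b))(s := Suc ((h(s := b)) s))) \<le> 0"
              if "g \<in> increasing_maps k n" for g
              unfolding undo using pos[OF that] by simp
          qed
        qed
      qed
    qed
    then obtain h where h: "P \<sigma> h" "\<And>t. t < k \<Longrightarrow> h t = T t" by blast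
    have "minor k A g T = minor k A g h" by (rule minor_cong) (simp add: h(2))
    then show "0 \<le> \<sigma> * minor k A g T" using h(1) g by (simp add: P_def)
  qed
qed

lemma minors_eq:
  assumes X: "X \<in> carrier_mat n m"
  shows "minors k X = {minor k (\<lambda>i j. X $$ (i, j)) g h | g h. g \<in> increasing_maps k n \<and> h \<in> increasing_maps k m}"
    (is "_ = ?R")
proof -
  have sub: "det (submatrix X I J) = minor k (\<lambda>i j. X $$ (i, j)) (pick I) (pick J)"
    if "I \<subseteq> {..<n}" "J \<subseteq> {..<m}" "card I = k" "card J = k" for I J
  proof -
    have "{i. i < dim_row X \<and> i \<in> I} = I" "{j. j < dim_col X \<and> j \<in> J} = J" using that X by auto
    then show ?thesis using that by (simp add: submatrix_def minor_def)
  qed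
  show ?thesis
  proof (intro equalityI subsetI)
    fix d assume "d \<in> minors k X"
    then obtain I J where IJ: "I \<subseteq> {..<n}" "J \<subseteq> {..<m}" "card I = k" "card J = k" "d = det (submatrix X I J)"
      using X by (auto simp: minors_def)
    then show "d \<in> ?R"
      using sub[OF IJ(1-4)] increasing_maps_enumeration(1)[OF IJ(1,3)]
        increasing_maps_enumeration(1)[OF IJ(2,4)] by blast
  next
    fix d assume "d \<in> ?R"
    then obtain g h where g: "g \<in> increasing_maps k n" and h: "h \<in> increasing_maps k m"
      and d: "d = minor k (\<lambda>i j. X $$ (i, j)) g h" by blast
    let ?I = "g ` {..<k}" and ?J = "h ` {..<k}"
    note I = increasing_maps_image[OF g] and J = increasing_maps_image[OF h]
    have gI: "g r = pick ?I r" if "r < k" for r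
      using increasing_maps_unique[OF g increasing_maps_enumeration(1)[OF I] _ that]
        increasing_maps_enumeration(2)[OF I] by simp
    have hJ: "h r = pick ?J r" if "r < k" for r
      using increasing_maps_unique[OF h increasing_maps_enumeration(1)[OF J] _ that]
        increasing_maps_enumeration(2)[OF J] by simp
    have "d = det (submatrix X ?I ?J)"
      unfolding d sub[OF I(1) J(1) I(2) J(2)] by (rule minor_cong) (simp only: gI hJ)
    then show "d \<in> minors k X"
      using I J X unfolding minors_def by blast
  qed
qed

lemma oscillates_cong:
  assumes "\<And>i. i < N \<Longrightarrow> v i = v' i"
  shows "oscillates k N v \<longleftrightarrow> oscillates k N v'"
proof -
  have "alternates_along k v f \<longleftrightarrow> alternates_along k v' f" if f: "f \<in> increasing_maps (Suc k) N" for f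
    using assms increasing_mapsD(2)[OF f] by (simp add: alternates_along_def)
  then show ?thesis unfolding oscillates_def by blast
qed

lemma variation_bounding_iff:
  assumes X: "X \<in> carrier_mat n m" and k: "1 \<le> k"
  shows "variation_bounding (k - 1) X \<longleftrightarrow>
    (\<forall>u. \<not> oscillates k m u \<longrightarrow> \<not> oscillates k n (\<lambda>i. \<Sum>j<m. X $$ (i, j) * u j))"
proof -
  have changes: "sign_changes w \<le> int (k - 1) \<longleftrightarrow> \<not> oscillates k (dim_vec w) (\<lambda>i. w $ i)" for w
    using sign_changes_ge_iff_oscillates[OF k, of w] k by auto
  have image: "oscillates k n (\<lambda>i. (X *\<^sub>v w) $ i) \<longleftrightarrow> oscillates k n (\<lambda>i. \<Sum>j<m. X $$ (i, j) * w $ j)"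
    if w: "w \<in> carrier_vec m" for w
    using X w by (intro oscillates_cong) (auto simp: scalar_prod_def atLeast0LessThan)
  show ?thesis
  proof
    assume vb: "variation_bounding (k - 1) X"
    show "\<forall>u. \<not> oscillates k m u \<longrightarrow> \<not> oscillates k n (\<lambda>i. \<Sum>j<m. X $$ (i, j) * u j)"
    proof (intro allI impI)
      fix u :: "nat \<Rightarrow> real" assume u: "\<not> oscillates k m u"
      let ?w = "vec m u"
      have eq: "(\<lambda>i. \<Sum>j<m. X $$ (i, j) * ?w $ j) = (\<lambda>i. \<Sum>j<m. X $$ (i, j) * u j)" by auto
      show "\<not> oscillates k n (\<lambda>i. \<Sum>j<m. X $$ (i, j) * u j)"
      proof (cases "?w = 0\<^sub>v m")
        case True
        then have "u j = 0" if "j < m" for j using that by (metis index_vec index_zero_vec(1))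
        then show ?thesis
          using k by (intro blocks_imp_not_oscillates[where \<beta> = "\<lambda>_. 0"]) auto
      next
        case False
        have "\<not> oscillates k m (\<lambda>i. ?w $ i)" using u oscillates_cong[of m "\<lambda>i. ?w $ i" u k] by simp
        then have "sign_changes ?w \<le> int (k - 1)" unfolding changes by simp
        then have "sign_changes (X *\<^sub>v ?w) \<le> int (k - 1)"
          using vb False X unfolding variation_bounding_def by simp
        then show ?thesis using image[of ?w] X unfolding changes eq by simp
      qed
    qed
  next
    assume osc: "\<forall>u. \<not> oscillates k m u \<longrightarrow> \<not> oscillates k n (\<lambda>i. \<Sum>j<m. X $$ (i, j) * u j)"
    show "variation_bounding (k - 1) X"
      unfolding variation_bounding_def
    proof (intro ballI impI)
      fix w assume w: "w \<in> carrier_vec (dim_col X)" "sign_changes w \<le> int (k - 1)"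
      then have "\<not> oscillates k m (\<lambda>j. w $ j)" using X unfolding changes by simp
      then have "\<not> oscillates k n (\<lambda>i. \<Sum>j<m. X $$ (i, j) * w $ j)" using osc by simp
      then show "sign_changes (X *\<^sub>v w) \<le> int (k - 1)"
        unfolding changes using image[of w] w(1) X by simp
    qed
  qed
qed

text \<open>
  The library notion speaks of the set of columns; injectivity of \<open>col X\<close> turns coefficients of
  column numbers into coefficients of vectors.
\<close>

lemma lin_indpt_imp_columns_independent:
  assumes X: "X \<in> carrier_mat n m" and h: "h \<in> increasing_maps l m"
    and inj: "inj_on (col X) (h ` {..<l})"
    and li: "module.lin_indpt class_ring (module_vec TYPE(real) n) (col X ` h ` {..<l})"
  shows "columns_independent l n (\<lambda>i j. X $$ (i, j)) h"
  unfolding columns_independent_def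
proof (intro allI impI, rule ccontr)
  interpret vec_space "TYPE(real)" n .
  fix c s assume c: "\<forall>i<n. (\<Sum>s<l. X $$ (i, h s) * c s) = 0" and s: "s < l" and nz: "c s \<noteq> 0"
  let ?f = "\<lambda>t. col X (h t)"
  let ?S = "col X ` h ` {..<l}"
  have S: "?S = ?f ` {..<l}" by auto
  have inj_f: "inj_on ?f {..<l}"
    using comp_inj_on[OF increasing_maps_inj[OF h] inj] by (simp add: comp_def)
  define a where "a = (\<lambda>v. c (the_inv_into {..<l} ?f v))"
  have af: "a (?f t) = c t" if "t < l" for t
    using the_inv_into_f_f[OF inj_f] that by (simp add: a_def)
  have SC: "?S \<subseteq> carrier_vec n" using X by auto
  have "lincomb a ?S = 0\<^sub>v n"
  proof (rule eq_vecI)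
    show "dim_vec (lincomb a ?S) = dim_vec (0\<^sub>v n)" using lincomb_dim[OF _ SC] by simp
    fix i assume "i < dim_vec (0\<^sub>v n :: real vec)"
    then have i: "i < n" by simp
    have "lincomb a ?S $ i = (\<Sum>v\<in>?S. a v * v $ i)" by (rule lincomb_index[OF i SC])
    also have "\<dots> = (\<Sum>t<l. a (?f t) * ?f t $ i)" unfolding S by (subst sum.reindex[OF inj_f]) simp
    also have "\<dots> = (\<Sum>t<l. X $$ (i, h t) * c t)"
      using af increasing_mapsD(2)[OF h] i X by (intro sum.cong) (auto simp: mult.commute)
    finally show "lincomb a ?S $ i = 0\<^sub>v n $ i" using c i by simp
  qed
  moreover have "?f s \<in> ?S" using s by blast
  ultimately have "lin_dep ?S"
    using af[OF s] nz SC by (intro lin_dep_crit[where A = ?S and a = a and v = "?f s"]) auto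
  then show False using li by simp
qed

lemma not_maximal_imp_larger:
  assumes "\<not> maximal A P" and "P A"
  shows "\<exists>B. A \<subseteq> B \<and> P B \<and> B \<noteq> A"
  using assms unfolding maximal_def by auto

text \<open>
  The rank is the size of any maximal independent set of columns, so \<open>k\<close> independent columns are
  not yet maximal.
\<close>

lemma rank_gt_imp_columns_extend:
  assumes X: "X \<in> carrier_mat n m" and rank: "k < vec_space.rank n X"
    and indep: "any_columns_lin_indpt k X" and h: "h \<in> increasing_maps k m"
  shows "\<exists>L\<in>increasing_maps (Suc k) m.
    h ` {..<k} \<subseteq> L ` {..<Suc k} \<and> columns_independent (Suc k) n (\<lambda>i j. X $$ (i, j)) L"
proof -
  interpret vec_space "TYPE(real)" n .
  let ?J = "h ` {..<k}"
  note J = increasing_maps_image[OF h]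
  have inj: "inj_on (col X) ?J" and li: "lin_indpt (col X ` ?J)"
    using indep J X unfolding any_columns_lin_indpt_def by auto
  have cols: "set (cols X) = col X ` {..<m}" using X by (auto simp: cols_def atLeast0LessThan)
  let ?P = "\<lambda>T. T \<subseteq> set (cols X) \<and> lin_indpt T"
  have "card (col X ` ?J) = k" using card_image[OF inj] J(2) by simp
  then have "\<not> maximal (col X ` ?J) ?P" using rank_card_indpt[OF X, of "col X ` ?J"] rank by auto
  moreover have "?P (col X ` ?J)" using li J(1) cols by auto
  ultimately have "\<exists>B. col X ` ?J \<subseteq> B \<and> ?P B \<and> B \<noteq> col X ` ?J"
    by (rule not_maximal_imp_larger)
  then obtain B where B: "col X ` ?J \<subseteq> B" "B \<subseteq> set (cols X)" "lin_indpt B" "B \<noteq> col X ` ?J"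
    by (elim exE conjE)
  then obtain x where x: "x \<in> B" "x \<notin> col X ` ?J" by blast
  then obtain l where l: "l < m" "x = col X l" using B(2) cols by auto
  let ?L = "insert l ?J"
  have lJ: "l \<notin> ?J" using x(2) l(2) by blast
  have L: "?L \<subseteq> {..<m}" "card ?L = Suc k" using J l(1) lJ by auto
  note pick_L = increasing_maps_enumeration[OF L]
  have "lin_indpt (col X ` ?L)"
  proof (rule subset_li_is_li[OF B(3)])
    show "col X ` ?L \<subseteq> B" using B(1) x(1) l(2) by auto
  qed
  moreover have "inj_on (col X) ?L" using inj x(2) l(2) lJ by (simp add: inj_on_insert)
  ultimately have "columns_independent (Suc k) n (\<lambda>i j. X $$ (i, j)) (pick ?L)"
    using lin_indpt_imp_columns_independent[OF X pick_L(1)] unfolding pick_L(2) by simp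
  then show ?thesis using pick_L by (intro bexI[of _ "pick ?L"]) auto
qed

theorem theorem4:
  fixes X :: "real mat" and n m k :: nat
  assumes "X \<in> carrier_mat n m"
    and "1 \<le> k"
    and "k < vec_space.rank n X"
    and "any_columns_lin_indpt k X"
  shows "variation_bounding (k - 1) X \<longleftrightarrow> sign_consistent k X"
proof -
  note X = assms(1) and k = assms(2)
  let ?A = "\<lambda>i j. X $$ (i, j)"
  have km: "k \<le> m" using vec_space.rank_le_nc[OF X] assms(3) by simp
  have indep: "columns_independent k n ?A h" if h: "h \<in> increasing_maps k m" for h
    using assms(4) increasing_maps_image[OF h] X
    by (intro lin_indpt_imp_columns_independent[OF X h]) (auto simp: any_columns_lin_indpt_def)
  have consistent: "sign_consistent k X \<longleftrightarrow> (\<exists>\<sigma>::real. \<sigma> \<noteq> 0 \<and>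
      (\<forall>g\<in>increasing_maps k n. \<forall>h\<in>increasing_maps k m. 0 \<le> \<sigma> * minor k ?A g h))" (is "_ \<longleftrightarrow> ?S")
  proof
    assume "sign_consistent k X"
    then consider "\<forall>d\<in>minors k X. 0 \<le> d" | "\<forall>d\<in>minors k X. d \<le> 0" unfolding sign_consistent_def by blast
    then show ?S
    proof cases
      case 1
      then show ?S unfolding minors_eq[OF X] by (intro exI[of _ 1]) auto
    next
      case 2
      then show ?S unfolding minors_eq[OF X] by (intro exI[of _ "- 1"]) auto
    qed
  next
    assume ?S
    then obtain \<sigma> :: real where \<sigma>: "\<sigma> \<noteq> 0"
      "\<And>d. d \<in> minors k X \<Longrightarrow> 0 \<le> \<sigma> * d" unfolding minors_eq[OF X] by blast
    show "sign_consistent k X"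
    proof (cases "0 < \<sigma>")
      case True
      then show ?thesis using \<sigma>(2) by (auto simp: sign_consistent_def zero_le_mult_iff)
    next
      case False
      then have "\<sigma> < 0" using \<sigma>(1) by simp
      then show ?thesis using \<sigma>(2) by (auto simp: sign_consistent_def zero_le_mult_iff)
    qed
  qed
  show ?thesis
    unfolding variation_bounding_iff[OF X k] consistent
  proof
    assume vb: "\<forall>u. \<not> oscillates k m u \<longrightarrow> \<not> oscillates k n (\<lambda>i. \<Sum>j<m. ?A i j * u j)"
    show ?S
    proof (rule not_oscillates_imp_sign_consistent[where A = ?A, OF k indep])
      show "\<exists>L\<in>increasing_maps (Suc k) m. h ` {..<k} \<subseteq> L ` {..<Suc k} \<and>
          columns_independent (Suc k) n ?A L" if "h \<in> increasing_maps k m" for h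
        by (rule rank_gt_imp_columns_extend[OF X assms(3,4) that])
      show "\<not> oscillates k n (\<lambda>i. \<Sum>j<m. ?A i j * u j)" if "\<not> oscillates k m u" for u
        using vb that by blast
    next
      fix \<sigma> :: real
      assume "\<sigma> \<noteq> 0" and "\<And>g h. g \<in> increasing_maps k n \<Longrightarrow> h \<in> increasing_maps k m \<Longrightarrow> 0 \<le> \<sigma> * minor k ?A g h"
      then show ?S by blast
    qed
  next
    assume ?S
    then obtain \<sigma> :: real where \<sigma>: "\<sigma> \<noteq> 0"
      and nonneg: "\<And>g h. g \<in> increasing_maps k n \<Longrightarrow> h \<in> increasing_maps k m \<Longrightarrow> 0 \<le> \<sigma> * minor k ?A g h"
      by blast
    show "\<forall>u. \<not> oscillates k m u \<longrightarrow> \<not> oscillates k n (\<lambda>i. \<Sum>j<m. ?A i j * u j)"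
    proof (intro allI impI)
      fix u assume u: "\<not> oscillates k m u"
      show "\<not> oscillates k n (\<lambda>i. \<Sum>j<m. ?A i j * u j)"
        by (rule sign_consistent_imp_not_oscillates[where A = ?A and \<sigma> = \<sigma>, OF k km indep nonneg \<sigma> u])
    qed
  qed
qed

end
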